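(* Let $M^3$ be an indefinite improper affine hypersphere of $\mathbb{R}^4$ which admits a pointwise $S_3$-symmetry, and assume that the invariant functions satisfy $(\alpha_{22},\alpha_{23})=(0,0)$ everywhere. Then $M^3$ admits coordinates $(t,v,w)$ and there is a function $k$ of $(v,w)$ such that $a_6=e^k$, where $k$ satisfies the elliptic PDE $$\Big(\tfrac{\partial^2}{\partial v^2}+\tfrac{\partial^2}{\partial w^2}\Big)k=6e^{\frac43k}.$$
   Context: Setting: $\varphi:M^3\to\mathbb{R}^4$ nondegenerate hypersurface with Blaschke normal $\xi$, $D_X\varphi_*Y=\varphi_*(\nabla_XY)+h(X,Y)\xi$, $D_X\xi=-\varphi_*(SX)$; $h$ affine metric (Lorentzian), $K=\nabla-\hat\nabla$ the difference tensor, $\hat\nabla$ the Levi-Civita connection of $h$. Affine hypersphere: $S=H\,\mathrm{Id}$, $H$ constant; improper if $H=0$. Pointwise $G$-symmetry: for every $p$ the group of $h_p$-isometries $L$ of $T_pM$ with $\det L=1$ and $K_p(LX,LY)=LK_p(X,Y)$ is isomorphic to $G$. Under pointwise $S_3$-symmetry there is locally an $h$-orthonormal frame $\{T,V,W\}$ ($h(T,T)=-1$, $h(V,V)=h(W,W)=1$) and a function $a_6>0$ with $K(T,X)=0$ for all $X$, $K(V,V)=a_6V$, $K(V,W)=-a_6W$, $K(W,W)=-a_6V$; the invariant functions are $\alpha_{22}:=h(\hat\nabla_VT,V)$ and $\alpha_{23}:=h(\hat\nabla_VT,W)$. *)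

theory Defs
  imports "HOL-Analysis.Analysis" "HOL-Algebra.Sym_Groups"
begin

(* Everything is done in a local chart: the hypersurface is a parametrisation
   phi : U \<subseteq> R^3 \<rightarrow> R^4, U open; tangent vectors at p are coordinate vectors in real^3
   (X = \<Sum> X$i \<partial>_i). *)

definition pd :: "(real^'n \<Rightarrow> 'b::real_normed_vector) \<Rightarrow> 'n \<Rightarrow> real^'n \<Rightarrow> 'b" where
  "pd f i p = vector_derivative (\<lambda>s. f (p + s *\<^sub>R axis i 1)) (at 0)"

fun Ck :: "nat \<Rightarrow> (real^'n) set \<Rightarrow> (real^'n \<Rightarrow> 'b::real_normed_vector) \<Rightarrow> bool" where
  "Ck 0 S f = continuous_on S f"
| "Ck (Suc n) S f = (continuous_on S f \<and>
      (\<forall>x\<in>S. \<forall>i. (\<lambda>s. f (x + s *\<^sub>R axis i 1)) differentiable (at 0)) \<and>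
      (\<forall>i. Ck n S (pd f i)))"

definition smooth_on :: "(real^'n) set \<Rightarrow> (real^'n \<Rightarrow> 'b::real_normed_vector) \<Rightarrow> bool" where
  "smooth_on S f \<longleftrightarrow> (\<forall>n. Ck n S f)"

definition emb34 :: "3 \<Rightarrow> 4" where
  "emb34 k = (if k = 1 then 1 else if k = 2 then 2 else 3)"

definition frame_mat :: "(real^3 \<Rightarrow> real^4) \<Rightarrow> (real^3 \<Rightarrow> real^4) \<Rightarrow> real^3 \<Rightarrow> real^4^4" where
  "frame_mat phi xi p = (\<chi> r c. (if c = 1 then pd phi 1 p else if c = 2 then pd phi 2 p
                                   else if c = 3 then pd phi 3 p else xi p) $ r)"

definition coef :: "(real^3 \<Rightarrow> real^4) \<Rightarrow> (real^3 \<Rightarrow> real^4) \<Rightarrow> real^3 \<Rightarrow> real^4 \<Rightarrow> real^4" where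
  "coef phi xi p v = matrix_inv (frame_mat phi xi p) *v v"

(* D_{\<partial>i} phi_* \<partial>j = phi_*(\<nabla>_{\<partial>i} \<partial>j) + h(\<partial>i,\<partial>j) xi *)
definition aff_metric :: "(real^3 \<Rightarrow> real^4) \<Rightarrow> (real^3 \<Rightarrow> real^4) \<Rightarrow> real^3 \<Rightarrow> real^3^3" where
  "aff_metric phi xi p = (\<chi> i j. coef phi xi p (pd (pd phi j) i p) $ 4)"

(* induced connection: \<nabla>_{\<partial>i} \<partial>j = \<Sum>k Gam k i j \<partial>k *)
definition ind_conn :: "(real^3 \<Rightarrow> real^4) \<Rightarrow> (real^3 \<Rightarrow> real^4) \<Rightarrow> real^3 \<Rightarrow> 3 \<Rightarrow> 3 \<Rightarrow> 3 \<Rightarrow> real" where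
  "ind_conn phi xi p k i j = coef phi xi p (pd (pd phi j) i p) $ emb34 k"

(* affine shape operator: D_{\<partial>i} xi = - phi_*(S \<partial>i) + (transversal part) ; S \<partial>i = \<Sum>k S k i \<partial>k *)
definition shape_op :: "(real^3 \<Rightarrow> real^4) \<Rightarrow> (real^3 \<Rightarrow> real^4) \<Rightarrow> real^3 \<Rightarrow> real^3^3" where
  "shape_op phi xi p = (\<chi> k i. - (coef phi xi p (pd xi i p) $ emb34 k))"

definition blaschke_hypersurface :: "(real^3) set \<Rightarrow> (real^3 \<Rightarrow> real^4) \<Rightarrow> (real^3 \<Rightarrow> real^4) \<Rightarrow> bool" where
  "blaschke_hypersurface U phi xi \<longleftrightarrow> open U \<and> smooth_on U phi \<and> smooth_on U xi \<and>
     (\<forall>p\<in>U. det (frame_mat phi xi p) \<noteq> 0 \<and>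
             det (aff_metric phi xi p) \<noteq> 0 \<and>
             (\<forall>i. coef phi xi p (pd xi i p) $ 4 = 0) \<and>
             \<bar>det (frame_mat phi xi p)\<bar> = sqrt \<bar>det (aff_metric phi xi p)\<bar>)"

(* improper affine hypersphere: S = H Id with H = 0 *)
definition improper_affine_hypersphere :: "(real^3) set \<Rightarrow> (real^3 \<Rightarrow> real^4) \<Rightarrow> (real^3 \<Rightarrow> real^4) \<Rightarrow> bool" where
  "improper_affine_hypersphere U phi xi \<longleftrightarrow> blaschke_hypersurface U phi xi \<and>
     (\<forall>p\<in>U. shape_op phi xi p = 0)"

definition lorentzian :: "real^3^3 \<Rightarrow> bool" where
  "lorentzian g \<longleftrightarrow> g = transpose g \<and>
     (\<exists>e1 e2 e3. e1 \<bullet> (g *v e1) = -1 \<and> e2 \<bullet> (g *v e2) = 1 \<and> e3 \<bullet> (g *v e3) = 1 \<and>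
        e1 \<bullet> (g *v e2) = 0 \<and> e1 \<bullet> (g *v e3) = 0 \<and> e2 \<bullet> (g *v e3) = 0)"

definition lc_conn :: "(real^3 \<Rightarrow> real^4) \<Rightarrow> (real^3 \<Rightarrow> real^4) \<Rightarrow> real^3 \<Rightarrow> 3 \<Rightarrow> 3 \<Rightarrow> 3 \<Rightarrow> real" where
  "lc_conn phi xi p k i j =
     (let g = aff_metric phi xi; gi = matrix_inv (g p);
          dg = (\<lambda>l a b. pd (\<lambda>q. g q $ a $ b) l p)
      in (1/2) * (\<Sum>l\<in>UNIV. gi $ k $ l * (dg i j l + dg j i l - dg l i j)))"

definition diff_tensor :: "(real^3 \<Rightarrow> real^4) \<Rightarrow> (real^3 \<Rightarrow> real^4) \<Rightarrow> real^3 \<Rightarrow> real^3 \<Rightarrow> real^3 \<Rightarrow> real^3" where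
  "diff_tensor phi xi p X Y =
     (\<chi> k. \<Sum>i\<in>UNIV. \<Sum>j\<in>UNIV. X $ i * Y $ j * (ind_conn phi xi p k i j - lc_conn phi xi p k i j))"

definition hform :: "(real^3 \<Rightarrow> real^4) \<Rightarrow> (real^3 \<Rightarrow> real^4) \<Rightarrow> real^3 \<Rightarrow> real^3 \<Rightarrow> real^3 \<Rightarrow> real" where
  "hform phi xi p X Y = X \<bullet> (aff_metric phi xi p *v Y)"

definition sym_grp :: "(real^3 \<Rightarrow> real^4) \<Rightarrow> (real^3 \<Rightarrow> real^4) \<Rightarrow> real^3 \<Rightarrow> (real^3^3) monoid" where
  "sym_grp phi xi p =
     \<lparr> carrier = {L. (\<forall>X Y. hform phi xi p (L *v X) (L *v Y) = hform phi xi p X Y) \<and> det L = 1 \<and>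
                     (\<forall>X Y. diff_tensor phi xi p (L *v X) (L *v Y) = L *v diff_tensor phi xi p X Y)},
       mult = (\<lambda>A B. A ** B), one = mat 1 \<rparr>"

definition pointwise_S3_symmetric :: "(real^3) set \<Rightarrow> (real^3 \<Rightarrow> real^4) \<Rightarrow> (real^3 \<Rightarrow> real^4) \<Rightarrow> bool" where
  "pointwise_S3_symmetric U phi xi \<longleftrightarrow> (\<forall>p\<in>U. sym_grp phi xi p \<cong> sym_group 3)"

definition lc_cov :: "(real^3 \<Rightarrow> real^4) \<Rightarrow> (real^3 \<Rightarrow> real^4) \<Rightarrow> real^3 \<Rightarrow> real^3 \<Rightarrow> (real^3 \<Rightarrow> real^3) \<Rightarrow> real^3" where
  "lc_cov phi xi p X Y =
     (\<Sum>i\<in>UNIV. X $ i *\<^sub>R pd Y i p) +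
     (\<chi> k. \<Sum>i\<in>UNIV. \<Sum>j\<in>UNIV. X $ i * Y p $ j * lc_conn phi xi p k i j)"

definition S3_frame :: "(real^3) set \<Rightarrow> (real^3 \<Rightarrow> real^4) \<Rightarrow> (real^3 \<Rightarrow> real^4) \<Rightarrow>
    (real^3 \<Rightarrow> real^3) \<Rightarrow> (real^3 \<Rightarrow> real^3) \<Rightarrow> (real^3 \<Rightarrow> real^3) \<Rightarrow> (real^3 \<Rightarrow> real) \<Rightarrow> bool" where
  "S3_frame U phi xi T V W a6 \<longleftrightarrow>
     smooth_on U T \<and> smooth_on U V \<and> smooth_on U W \<and> smooth_on U a6 \<and>
     (\<forall>p\<in>U. let h = hform phi xi p; K = diff_tensor phi xi p in
        h (T p) (T p) = -1 \<and> h (V p) (V p) = 1 \<and> h (W p) (W p) = 1 \<and>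
        h (T p) (V p) = 0 \<and> h (T p) (W p) = 0 \<and> h (V p) (W p) = 0 \<and>
        a6 p > 0 \<and>
        (\<forall>X. K (T p) X = 0) \<and>
        K (V p) (V p) = a6 p *\<^sub>R V p \<and>
        K (V p) (W p) = - (a6 p *\<^sub>R W p) \<and>
        K (W p) (W p) = - (a6 p *\<^sub>R V p))"

definition alpha22 where
  "alpha22 phi xi T V W p = hform phi xi p (lc_cov phi xi p (V p) T) (V p)"
definition alpha23 where
  "alpha23 phi xi T V W p = hform phi xi p (lc_cov phi xi p (V p) T) (W p)"

definition vw :: "real^3 \<Rightarrow> real^2" where
  "vw x = vector [x $ 2, x $ 3]"

definition lap2 :: "(real^2 \<Rightarrow> real) \<Rightarrow> real^2 \<Rightarrow> real" where
  "lap2 k y = pd (pd k 1) 1 y + pd (pd k 2) 2 y"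

end

theory Submission
  imports Defs
begin

text \<open>
  Let lT, lV, lW be the h-duals of the frame and th3 = h(D V, W) the Levi-Civita connection form.
  Since xi is constant, the derivatives of the moving frame (phi_* T, phi_* V, phi_* W, xi) close up,
  and the symmetry of second derivatives makes its matrix of connection forms flat. The entries of
  this one matrix equation are the Codazzi, Gauss and torsion equations. When alpha22 = alpha23 = 0
  they force T to be parallel, the forms lT, a^(1/3) lV, a^(1/3) lW to be closed, and T(a) = 0.
  Primitives of these closed forms are the coordinates (t, v, w) up to the sign of t. In them
  th3 = (k_w dv - k_v dw) / 3 with k = ln a, so the Gauss equation d th3 = - 2 a^2 lV \<and> lW is the PDE.
\<close>

section \<open>Partial derivatives along the axes\<close>

text \<open>Put l = \<open>lV\<close> + i \<open>lW\<close>. The cubic form h(K(Z,Z),Z) is the real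
  part of a l(Z)^3, and this complex structure governs every step. On the frame the Levi-Civita part
  of the connection matrix is skew for h and the K part symmetric, so comparing an entry of the
  flatness equation with the transposed entry separates derivative terms from Codazzi terms. The T
  entries give l wedge (th1 + i th2) = 0, hence th1 + i th2 = (alpha22 + i alpha23) l: the vanishing
  of two functions kills two whole 1-forms and makes T parallel. The exponent 1/3 is that of the
  cube root of a l^3, which plays the part of dv + i dw. On the leaves the metric is then a^(-2/3)
  (dv^2 + dw^2), so the curvature term 2 a^2 gets the area factor a^(-2/3) and becomes 2 a^(4/3) = 2
  e^(4k/3); the 1/3 in \<open>th3\<close> turns the 2 into 6. Smoothness is phrased through partial
  derivatives along the axes only. Total derivatives, symmetry of second derivatives, primitives of
  closed forms and smooth inverses are therefore derived from that notion before any
  geometry.\<close>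

definition has_pd :: "(real^'n \<Rightarrow> 'b::real_normed_vector) \<Rightarrow> 'b \<Rightarrow> 'n \<Rightarrow> real^'n \<Rightarrow> bool" where
  "has_pd f D i x \<longleftrightarrow> ((\<lambda>s. f (x + s *\<^sub>R axis i 1)) has_vector_derivative D) (at 0)"

lemma has_pd_imp_pd: "has_pd f D i x \<Longrightarrow> pd f i x = D"
  unfolding has_pd_def pd_def by (rule vector_derivative_at)

text \<open>\<open>pd\<close> is a choice and says nothing about existence; \<open>has_pd\<close>
  asserts it and composes by the derivative rules. This equivalence connects it to the
  differentiability clause of \<open>Ck\<close>.\<close>

lemma has_pd_pd_iff:
  "has_pd f (pd f i x) i x \<longleftrightarrow> (\<lambda>s. f (x + s *\<^sub>R axis i 1)) differentiable (at 0)"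
  unfolding has_pd_def pd_def by (rule vector_derivative_works[symmetric])

lemma has_pd_const: "has_pd (\<lambda>_. c) 0 i x"
  unfolding has_pd_def by (rule has_vector_derivative_const)

lemma has_pd_add:
  "has_pd f D i x \<Longrightarrow> has_pd g E i x \<Longrightarrow> has_pd (\<lambda>x. f x + g x) (D + E) i x"
  unfolding has_pd_def by (rule has_vector_derivative_add)

lemma (in bounded_linear) has_pd:
  "has_pd g D i x \<Longrightarrow> has_pd (\<lambda>x. f (g x)) (f D) i x"
  unfolding has_pd_def by (rule has_vector_derivative)

lemma (in bounded_bilinear) has_pd:
  "has_pd f D i x \<Longrightarrow> has_pd g E i x \<Longrightarrow>
     has_pd (\<lambda>x. prod (f x) (g x)) (prod (f x) E + prod D (g x)) i x"
  unfolding has_pd_def using has_vector_derivative[of "\<lambda>s. f (x + s *\<^sub>R axis i 1)" D 0 UNIV "\<lambda>s. g (x + s *\<^sub>R axis i 1)" E] by simp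

lemmas has_pd_scaleR = bounded_bilinear.has_pd[OF bounded_bilinear_scaleR]
lemmas has_pd_mult = bounded_bilinear.has_pd[OF bounded_bilinear_mult]
lemmas has_pd_vec_nth = bounded_linear.has_pd[OF bounded_linear_vec_nth]

lemma has_pd_minus: "has_pd f D i x \<Longrightarrow> has_pd (\<lambda>x. - f x) (- D) i x"
  by (rule bounded_linear.has_pd[OF bounded_linear_minus[OF bounded_linear_ident]])

lemma has_pd_diff:
  "has_pd f D i x \<Longrightarrow> has_pd g E i x \<Longrightarrow> has_pd (\<lambda>x. f x - g x) (D - E) i x"
  unfolding has_pd_def by (rule has_vector_derivative_diff)

lemma has_pd_sum:
  "(\<And>j. j \<in> J \<Longrightarrow> has_pd (f j) (D j) i x) \<Longrightarrow> has_pd (\<lambda>x. \<Sum>j\<in>J. f j x) (\<Sum>j\<in>J. D j) i x"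
  unfolding has_pd_def by (rule has_vector_derivative_sum)

lemma has_pd_real_compose:
  fixes f :: "real^'n \<Rightarrow> real"
  assumes "has_pd f D i x" "(g has_real_derivative E) (at (f x))"
  shows "has_pd (\<lambda>x. g (f x)) (E * D) i x"
  using assms unfolding has_pd_def has_real_derivative_iff_has_vector_derivative[symmetric]
  by (intro DERIV_chain2[of g E]) simp_all

lemma has_vector_derivative_compose_has_derivative:
  assumes "(g has_vector_derivative D) (at u)" "(f has_derivative f') (at (g u))"
  shows "((\<lambda>u. f (g u)) has_vector_derivative f' D) (at u)"
  using vector_derivative_diff_chain_within[of g D u UNIV f f'] assms
  by (simp add: o_def has_derivative_at_withinI)

lemma has_derivative_imp_has_pd:
  assumes "(f has_derivative f') (at x)"
  shows "has_pd f (f' (axis i 1)) i x"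
proof -
  have "((\<lambda>s. x + s *\<^sub>R axis i 1) has_vector_derivative axis i 1) (at (0::real))"
    by (auto intro!: derivative_eq_intros)
  from has_vector_derivative_compose_has_derivative[OF this, of f f'] show ?thesis
    using assms by (simp add: has_pd_def)
qed

lemma has_pd_compose:
  assumes "has_pd g D i x" "(f has_derivative f') (at (g x))"
  shows "has_pd (\<lambda>x. f (g x)) (f' D) i x"
  using has_vector_derivative_compose_has_derivative[of "\<lambda>s. g (x + s *\<^sub>R axis i 1)" D 0 f f'] assms
  by (simp add: has_pd_def)

text \<open>\<open>has_pd\<close> speaks of parameter 0 only. Recentring the line makes it available
  at every parameter, as mean value arguments along an axis require.\<close>

lemma has_pd_line:
  assumes "has_pd f D i (x + s *\<^sub>R axis i 1)"
  shows "((\<lambda>s. f (x + s *\<^sub>R axis i 1)) has_vector_derivative D) (at s)"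
proof -
  have "((\<lambda>t. f (x + s *\<^sub>R axis i 1 + t *\<^sub>R axis i 1)) has_derivative (\<lambda>h. h *\<^sub>R D)) (at (s - s))"
    using assms by (simp add: has_pd_def has_vector_derivative_def)
  moreover have "((\<lambda>t. t - s) has_derivative (\<lambda>h. h)) (at s)"
    by (auto intro!: derivative_eq_intros)
  ultimately have "((\<lambda>t. f (x + s *\<^sub>R axis i 1 + (t - s) *\<^sub>R axis i 1)) has_derivative (\<lambda>h. h *\<^sub>R D)) (at s)"
    by (rule has_derivative_compose[rotated])
  then show ?thesis
    by (simp add: has_vector_derivative_def algebra_simps)
qed

lemma has_pd_cong_open:
  assumes "open S" "x \<in> S" "\<And>y. y \<in> S \<Longrightarrow> f y = g y" "has_pd f D i x"
  shows "has_pd g D i x"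
  unfolding has_pd_def
proof (rule has_vector_derivative_transform_within_open)
  show "((\<lambda>s. f (x + s *\<^sub>R axis i 1)) has_vector_derivative D) (at 0)"
    using assms(4) by (simp add: has_pd_def)
  show "open ((\<lambda>s::real. x + s *\<^sub>R axis i 1) -` S)"
    by (intro open_vimage assms(1) continuous_intros)
qed (use assms in auto)

text \<open>The two functions have the same candidate derivatives at x, so the choice behind
  \<open>pd\<close> picks the same value, differentiable or not.\<close>

lemma pd_cong_open:
  assumes "open S" "x \<in> S" "\<And>y. y \<in> S \<Longrightarrow> f y = g y"
  shows "pd f i x = pd g i x"
proof -
  have "has_pd f D i x \<longleftrightarrow> has_pd g D i x" for D
    using has_pd_cong_open[OF assms(1,2), of f g] has_pd_cong_open[OF assms(1,2), of g f] assms(3)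
    by auto
  then show ?thesis
    unfolding pd_def vector_derivative_def has_pd_def by presburger
qed

section \<open>Functions of class C^n and their closure properties\<close>

lemma Ck_Suc:
  "Ck (Suc n) S f \<longleftrightarrow> continuous_on S f \<and> (\<forall>x\<in>S. \<forall>i. has_pd f (pd f i x) i x) \<and> (\<forall>i. Ck n S (pd f i))"
  by (simp add: has_pd_pd_iff)

declare Ck.simps(2) [simp del]

lemma Ck_continuous: "Ck n S f \<Longrightarrow> continuous_on S f"
  by (cases n) (auto simp: Ck_Suc)

lemma Ck_cong:
  assumes "open S" "\<And>x. x \<in> S \<Longrightarrow> f x = g x" "Ck n S f"
  shows "Ck n S g"
  using assms(2,3)
proof (induction n arbitrary: f g)
  case 0
  then show ?case
    using continuous_on_cong[of S S f g] by simp
next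
  case (Suc n)
  have *: "pd f i x = pd g i x" if "x \<in> S" for i x
    using pd_cong_open[OF assms(1) that] Suc.prems(1) by blast
  have "has_pd g (pd g i x) i x" if "x \<in> S" for i x
    using has_pd_cong_open[OF assms(1) that, of f g] Suc.prems *[OF that] that by (metis Ck_Suc)
  moreover have "Ck n S (pd g i)" for i
    using Suc.IH[of "pd f i" "pd g i"] Suc.prems * by (simp add: Ck_Suc)
  moreover have "continuous_on S g"
    using continuous_on_cong[of S S f g] Suc.prems by (simp add: Ck_Suc)
  ultimately show ?case
    by (simp add: Ck_Suc)
qed

text \<open>The standard way to climb in n: explicit candidates for the partials agree with
  \<open>pd\<close> on S, and since S is open \<open>Ck_cong\<close> may exchange them.\<close>

lemma Ck_SucI:
  assumes "open S" "continuous_on S f" "\<And>x i. x \<in> S \<Longrightarrow> has_pd f (g i x) i x" "\<And>i. Ck n S (g i)"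
  shows "Ck (Suc n) S f"
proof -
  have "g i x = pd f i x" if "x \<in> S" for i x
    using assms(3)[OF that] has_pd_imp_pd by metis
  then show ?thesis
    using assms Ck_cong[OF assms(1), of "g i" "pd f i" n for i] by (auto simp: Ck_Suc)
qed

lemma Ck_Suc_imp: "Ck (Suc n) S f \<Longrightarrow> Ck n S f"
  by (induction n arbitrary: f) (auto simp: Ck_Suc)

lemma Ck_mono: "Ck n S f \<Longrightarrow> m \<le> n \<Longrightarrow> Ck m S f"
  by (induction n) (use Ck_Suc_imp le_Suc_eq in blast)+

lemma Ck_subset: "Ck n S f \<Longrightarrow> T \<subseteq> S \<Longrightarrow> Ck n T f"
  by (induction n arbitrary: f) (auto simp: Ck_Suc intro: continuous_on_subset)

lemma Ck_const: "open S \<Longrightarrow> Ck n S (\<lambda>_. c)"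
proof (induction n arbitrary: c)
  case (Suc n)
  then show ?case
    by (intro Ck_SucI[where g="\<lambda>_ _. 0"] has_pd_const) auto
qed simp

lemma Ck_add:
  assumes "open S"
  shows "Ck n S f \<Longrightarrow> Ck n S g \<Longrightarrow> Ck n S (\<lambda>x. f x + g x)"
proof (induction n arbitrary: f g)
  case (Suc n)
  then show ?case
    by (intro Ck_SucI[where g="\<lambda>i x. pd f i x + pd g i x"] has_pd_add assms)
      (auto simp: Ck_Suc intro: continuous_intros)
qed (auto intro: continuous_intros)

lemma (in bounded_linear) Ck:
  assumes "open S"
  shows "Ck n S g \<Longrightarrow> Ck n S (\<lambda>x. f (g x))"
proof (induction n arbitrary: g)
  case (Suc n)
  then show ?case
    by (intro Ck_SucI[where g="\<lambda>i x. f (pd g i x)"] has_pd assms)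
      (auto simp: Ck_Suc intro: continuous_on)
qed (auto intro: continuous_on)

lemma (in bounded_bilinear) Ck:
  assumes "open S"
  shows "Ck n S f \<Longrightarrow> Ck n S g \<Longrightarrow> Ck n S (\<lambda>x. prod (f x) (g x))"
proof (induction n arbitrary: f g)
  case (Suc n)
  note n = Suc.prems[THEN Ck_Suc_imp]
  show ?case
    using Suc n
    by (intro Ck_SucI[where g="\<lambda>i x. prod (f x) (pd g i x) + prod (pd f i x) (g x)"] has_pd assms Ck_add)
      (auto simp: Ck_Suc intro: continuous_on)
qed (auto intro: continuous_on)

lemmas Ck_scaleR = bounded_bilinear.Ck[OF bounded_bilinear_scaleR]
lemmas Ck_mult = bounded_bilinear.Ck[OF bounded_bilinear_mult]
lemmas Ck_vec_nth = bounded_linear.Ck[OF bounded_linear_vec_nth]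
lemmas Ck_minus = bounded_linear.Ck[OF bounded_linear_minus[OF bounded_linear_ident]]

lemma Ck_diff:
  assumes "open S" "Ck n S f" "Ck n S g"
  shows "Ck n S (\<lambda>x. f x - g x)"
  using Ck_add[OF assms(1,2) Ck_minus[OF assms(1,3)]] by simp

lemma Ck_sum:
  assumes "open S" "\<And>j. j \<in> J \<Longrightarrow> Ck n S (f j)"
  shows "Ck n S (\<lambda>x. \<Sum>j\<in>J. f j x)"
  using assms(2)
  by (induction J rule: infinite_finite_induct) (auto intro!: Ck_const Ck_add assms(1))

lemma Ck_prod:
  fixes f :: "'j \<Rightarrow> real^'n \<Rightarrow> real"
  assumes "open S" "\<And>j. j \<in> J \<Longrightarrow> Ck n S (f j)"
  shows "Ck n S (\<lambda>x. \<Prod>j\<in>J. f j x)"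
  using assms(2)
  by (induction J rule: infinite_finite_induct) (auto intro!: Ck_const Ck_mult assms(1))

lemma Ck_vec:
  fixes f :: "real^'n \<Rightarrow> real^'m"
  assumes "open S" "\<And>i. Ck n S (\<lambda>x. f x $ i)"
  shows "Ck n S f"
proof -
  have "Ck n S (\<lambda>x. \<Sum>i\<in>UNIV. f x $ i *\<^sub>R (axis i 1 :: real^'m))"
    by (intro Ck_sum Ck_scaleR Ck_const assms)
  moreover have "(\<Sum>i\<in>UNIV. f x $ i *\<^sub>R (axis i 1 :: real^'m)) = f x" for x
    using basis_expansion[of "f x"] by (simp add: scalar_mult_eq_scaleR)
  ultimately show ?thesis
    by simp
qed

text \<open>The derivative of 1/f is a product of copies of 1/f and a partial of f, so the induction
  on n closes on itself.\<close>

lemma Ck_inverse: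
  fixes f :: "real^'n \<Rightarrow> real"
  assumes "open S" "\<And>x. x \<in> S \<Longrightarrow> f x \<noteq> 0"
  shows "Ck n S f \<Longrightarrow> Ck n S (\<lambda>x. inverse (f x))"
proof (induction n)
  case 0
  then show ?case
    using assms(2) by (auto intro!: continuous_intros)
next
  case (Suc n)
  note IH = Suc.IH[OF Ck_Suc_imp[OF Suc.prems]]
  show ?case
  proof (rule Ck_SucI[where g="\<lambda>i x. - (inverse (f x) * inverse (f x)) * pd f i x", OF assms(1)])
    show "continuous_on S (\<lambda>x. inverse (f x))"
      using Ck_continuous[OF Suc.prems] assms(2) by (auto intro!: continuous_intros)
    show "has_pd (\<lambda>x. inverse (f x)) (- (inverse (f x) * inverse (f x)) * pd f i x) i x" if "x \<in> S" for i x
      using Suc.prems assms(2) that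
      by (intro has_pd_real_compose) (auto simp: Ck_Suc power2_eq_square intro!: derivative_eq_intros)
    show "Ck n S (\<lambda>x. - (inverse (f x) * inverse (f x)) * pd f i x)" for i
      using Suc.prems by (intro Ck_mult Ck_minus IH assms(1)) (simp add: Ck_Suc)
  qed
qed

lemma Ck_divide:
  fixes f :: "real^'n \<Rightarrow> real"
  assumes "open S" "Ck n S f" "Ck n S g" "\<And>x. x \<in> S \<Longrightarrow> g x \<noteq> 0"
  shows "Ck n S (\<lambda>x. f x / g x)"
  unfolding divide_inverse by (intro Ck_mult Ck_inverse assms)

lemma Ck_ln:
  fixes f :: "real^'n \<Rightarrow> real"
  assumes "open S" "\<And>x. x \<in> S \<Longrightarrow> f x > 0" "Ck n S f"
  shows "Ck n S (\<lambda>x. ln (f x))"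
proof (cases n)
  case 0
  then show ?thesis
    using assms by (force intro!: continuous_intros)
next
  case (Suc m)
  have C: "Ck (Suc m) S f"
    using assms Suc by simp
  have pos: "f x \<noteq> 0" if "x \<in> S" for x
    using assms(2)[OF that] by simp
  show ?thesis
    unfolding Suc
  proof (rule Ck_SucI[where g="\<lambda>i x. inverse (f x) * pd f i x", OF assms(1)])
    show "continuous_on S (\<lambda>x. ln (f x))"
      using Ck_continuous[OF assms(3)] assms(2) by (force intro!: continuous_intros)
    show "has_pd (\<lambda>x. ln (f x)) (inverse (f x) * pd f i x) i x" if "x \<in> S" for i x
      using C assms(2)[OF that] that
      by (intro has_pd_real_compose DERIV_ln) (auto simp: Ck_Suc)
    show "Ck m S (\<lambda>x. inverse (f x) * pd f i x)" for i
      using C Ck_Suc_imp[OF C] pos by (intro Ck_mult Ck_inverse assms(1)) (simp_all add: Ck_Suc)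
  qed
qed

lemma Ck_exp:
  fixes f :: "real^'n \<Rightarrow> real"
  assumes "open S"
  shows "Ck n S f \<Longrightarrow> Ck n S (\<lambda>x. exp (f x))"
proof (induction n)
  case 0
  then show ?case
    by (auto intro!: continuous_intros)
next
  case (Suc n)
  show ?case
  proof (rule Ck_SucI[where g="\<lambda>i x. exp (f x) * pd f i x", OF assms(1)])
    show "continuous_on S (\<lambda>x. exp (f x))"
      using Ck_continuous[OF Suc.prems] by (auto intro!: continuous_intros)
    show "has_pd (\<lambda>x. exp (f x)) (exp (f x) * pd f i x) i x" if "x \<in> S" for i x
      using Suc.prems that
      by (intro has_pd_real_compose) (auto simp: Ck_Suc intro!: derivative_eq_intros)
    show "Ck n S (\<lambda>x. exp (f x) * pd f i x)" for i
      using Suc.prems Suc.IH[OF Ck_Suc_imp[OF Suc.prems]] by (intro Ck_mult assms(1)) (simp_all add: Ck_Suc)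
  qed
qed

section \<open>Determinants and inverse matrices\<close>

lemma Ck_det:
  fixes A :: "real^'n \<Rightarrow> real^'m^'m"
  assumes "open S" "\<And>i j. Ck n S (\<lambda>x. A x $ i $ j)"
  shows "Ck n S (\<lambda>x. det (A x))"
  unfolding det_def by (intro Ck_sum Ck_mult Ck_const Ck_prod assms)

lemma matrix_inv_mult_vector:
  fixes A :: "real^'n^'n"
  assumes "det A \<noteq> 0"
  shows "A *v (matrix_inv A *v v) = v" "matrix_inv A *v (A *v v) = v"
proof -
  have "\<exists>B. A ** B = mat 1 \<and> B ** A = mat 1"
    using assms by (simp only: invertible_det_nz[symmetric] invertible_def)
  then have *: "A ** matrix_inv A = mat 1 \<and> matrix_inv A ** A = mat 1"
    unfolding matrix_inv_def by (rule someI_ex)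
  show "A *v (matrix_inv A *v v) = v" "matrix_inv A *v (A *v v) = v"
    using * by (simp_all only: matrix_vector_mul_assoc matrix_vector_mul_lid)
qed

text \<open>Cramer's rule writes each component as a quotient of determinants with nonvanishing
  denominator. It yields the smoothness of \<open>coef\<close>, hence of the affine metric, and
  through the matrix inverse that of the Levi-Civita symbols.\<close>

lemma Ck_matrix_inv_vector:
  fixes A :: "real^'n \<Rightarrow> real^'m^'m"
  assumes "open S" "\<And>i j. Ck n S (\<lambda>x. A x $ i $ j)" "\<And>x. x \<in> S \<Longrightarrow> det (A x) \<noteq> 0"
    "\<And>i. Ck n S (\<lambda>x. v x $ i)"
  shows "Ck n S (\<lambda>x. (matrix_inv (A x) *v v x) $ k)"
proof (rule Ck_cong[OF assms(1)])
  show "Ck n S (\<lambda>x. det (\<chi> i j. if j = k then v x $ i else A x $ i $ j) / det (A x))"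
  proof (intro Ck_divide Ck_det assms)
    show "Ck n S (\<lambda>x. (\<chi> i j. if j = k then v x $ i else A x $ i $ j) $ i $ j)" for i j
      using assms(2,4) by (cases "j = k") simp_all
  qed
  show "det (\<chi> i j. if j = k then v x $ i else A x $ i $ j) / det (A x) = (matrix_inv (A x) *v v x) $ k"
    if "x \<in> S" for x
    using cramer[of "A x" "matrix_inv (A x) *v v x" "v x"] assms(3)[OF that]
    by (simp add: matrix_inv_mult_vector)
qed

lemma Ck_matrix_inv:
  fixes A :: "real^'n \<Rightarrow> real^'m^'m"
  assumes "open S" "\<And>i j. Ck n S (\<lambda>x. A x $ i $ j)" "\<And>x. x \<in> S \<Longrightarrow> det (A x) \<noteq> 0"
  shows "Ck n S (\<lambda>x. matrix_inv (A x) $ k $ l)"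
proof -
  have *: "matrix_inv (A x) $ k $ l = (matrix_inv (A x) *v axis l 1) $ k" for x
    by (simp add: matrix_vector_mult_basis column_def)
  show ?thesis
    unfolding * by (rule Ck_matrix_inv_vector[OF assms Ck_const[OF assms(1)]])
qed

text \<open>The chain rule needs a total derivative. The increment is built up one coordinate at a
  time, and continuity of the partials controls the error of each change.\<close>

lemma has_derivative_partials:
  fixes f :: "real^'n \<Rightarrow> 'b::real_normed_vector"
  assumes "open S" "x \<in> S" "\<And>i y. y \<in> S \<Longrightarrow> has_pd f (f' i y) i y" "\<And>i. continuous_on S (f' i)"
  shows "(f has_derivative (\<lambda>h. \<Sum>i\<in>UNIV. h $ i *\<^sub>R f' i x)) (at x)"
proof -
  \<comment> \<open>Induction on the set of coordinates in which the increment may be nonzero.\<close>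
  have part: "\<exists>\<delta>>0. \<forall>h. norm h < \<delta> \<and> (\<forall>i. i \<notin> J \<longrightarrow> h $ i = 0) \<longrightarrow>
          norm (f (x + h) - f x - (\<Sum>i\<in>J. h $ i *\<^sub>R f' i x)) \<le> e * norm h"
    if "e > 0" for e :: real and J :: "'n set"
    using finite[of J] that
  proof (induction J arbitrary: e rule: finite_induct)
    case empty
    have z: "\<forall>i. h $ i = 0 \<Longrightarrow> h = 0" for h :: "real^'n"
      by (simp add: vec_eq_iff)
    show ?case
      by (intro exI[of _ 1]) (auto dest!: z)
  next
    case (insert j J)
    obtain d1 where d1: "d1 > 0"
      "\<And>h. norm h < d1 \<Longrightarrow> (\<forall>i. i \<notin> J \<longrightarrow> h $ i = 0) \<Longrightarrow>
          norm (f (x + h) - f x - (\<Sum>i\<in>J. h $ i *\<^sub>R f' i x)) \<le> (e/2) * norm h"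
      using insert.IH[of "e/2"] insert.prems by auto
    obtain d2 where d2: "d2 > 0" "ball x d2 \<subseteq> S"
      using assms(1,2) open_contains_ball by blast
    have "continuous_on S (f' j)"
      by (rule assms(4))
    then obtain d3 where d3: "d3 > 0" "\<And>y. y \<in> S \<Longrightarrow> dist y x < d3 \<Longrightarrow> dist (f' j y) (f' j x) < e/2"
      using assms(2) insert.prems unfolding continuous_on_iff by (metis half_gt_zero)
    have "norm (f (x + h) - f x - (\<Sum>i\<in>insert j J. h $ i *\<^sub>R f' i x)) \<le> e * norm h"
      if h: "norm h < Min {d1, d2, d3}" "\<forall>i. i \<notin> insert j J \<longrightarrow> h $ i = 0" for h
    proof -
      \<comment> \<open>\<open>h'\<close> is the increment with its j-th coordinate erased. The
        induction hypothesis covers the way from x to x + h'; the rest is a move along one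
        axis.\<close>
      define h' where "h' = h - (h $ j) *\<^sub>R axis j 1"
      have h'_nth: "h' $ i = (if i = j then 0 else h $ i)" for i
        by (simp add: h'_def axis_def)
      have le: "norm (h' + s *\<^sub>R axis j 1) \<le> norm h" if "\<bar>s\<bar> \<le> \<bar>h $ j\<bar>" for s
        by (rule norm_le_componentwise_cart) (use that in \<open>simp add: h'_nth axis_def\<close>)
      have le_j: "\<bar>h $ j\<bar> \<le> norm h"
        by (rule component_le_norm_cart)
      have inS: "x + h' + s *\<^sub>R axis j 1 \<in> S" "dist (x + h' + s *\<^sub>R axis j 1) x < d3" if "\<bar>s\<bar> \<le> \<bar>h $ j\<bar>" for s
      proof -
        have "dist (x + h' + s *\<^sub>R axis j 1) x = norm (h' + s *\<^sub>R axis j 1)"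
          by (simp add: dist_norm algebra_simps)
        then show "x + h' + s *\<^sub>R axis j 1 \<in> S" "dist (x + h' + s *\<^sub>R axis j 1) x < d3"
          using le[OF that] h(1) d2(2) by (auto simp: subset_eq dist_commute)
      qed
      have A: "norm (f (x + h') - f x - (\<Sum>i\<in>J. h' $ i *\<^sub>R f' i x)) \<le> (e/2) * norm h'"
        using d1(2)[of h'] h le[of 0] by (auto simp: h'_nth)
      have sumeq: "(\<Sum>i\<in>J. h' $ i *\<^sub>R f' i x) = (\<Sum>i\<in>J. h $ i *\<^sub>R f' i x)"
        by (intro sum.cong) (use insert.hyps in \<open>auto simp: h'_nth\<close>)
      \<comment> \<open>Subtracting the linear term leaves a derivative f'_j(y) - f'_j(x) of norm at
        most e/2, to which the mean value inequality applies.\<close>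
      define F where "F = (\<lambda>s. f (x + h' + s *\<^sub>R axis j 1) - s *\<^sub>R f' j x)"
      have "norm (F (h $ j) - F 0) \<le> (e/2) * norm (h $ j - 0)"
      proof (rule differentiable_bound[where S="closed_segment 0 (h $ j)"
            and f'="\<lambda>s d. d *\<^sub>R (f' j (x + h' + s *\<^sub>R axis j 1) - f' j x)"])
        fix s assume "s \<in> closed_segment 0 (h $ j)"
        then have s: "\<bar>s\<bar> \<le> \<bar>h $ j\<bar>"
          by (auto simp: closed_segment_eq_real_ivl split: if_splits)
        have "has_pd f (f' j (x + h' + s *\<^sub>R axis j 1)) j (x + h' + s *\<^sub>R axis j 1)"
          using inS(1)[OF s] by (rule assms(3))
        from has_pd_line[OF this]
        have "(F has_vector_derivative (f' j (x + h' + s *\<^sub>R axis j 1) - f' j x)) (at s)"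
          unfolding F_def by (auto intro!: derivative_eq_intros)
        then show "(F has_derivative (\<lambda>d. d *\<^sub>R (f' j (x + h' + s *\<^sub>R axis j 1) - f' j x)))
            (at s within closed_segment 0 (h $ j))"
          by (simp add: has_vector_derivative_def has_derivative_at_withinI)
        have "norm (f' j (x + h' + s *\<^sub>R axis j 1) - f' j x) \<le> e/2"
          using d3(2)[OF inS[OF s]] by (simp add: dist_norm)
        then show "onorm (\<lambda>d. d *\<^sub>R (f' j (x + h' + s *\<^sub>R axis j 1) - f' j x)) \<le> e/2"
          by (intro onorm_le) (metis mult.commute mult_left_mono norm_ge_zero norm_scaleR real_norm_def)
      qed auto
      then have B: "norm (f (x + h) - f (x + h') - (h $ j) *\<^sub>R f' j x) \<le> (e/2) * \<bar>h $ j\<bar>"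
        by (simp add: F_def h'_def algebra_simps)
      have "f (x + h) - f x - (\<Sum>i\<in>insert j J. h $ i *\<^sub>R f' i x) =
          (f (x + h) - f (x + h') - (h $ j) *\<^sub>R f' j x) + (f (x + h') - f x - (\<Sum>i\<in>J. h' $ i *\<^sub>R f' i x))"
        using insert.hyps by (simp add: sumeq)
      also have "norm \<dots> \<le> (e/2) * \<bar>h $ j\<bar> + (e/2) * norm h'"
        by (rule norm_triangle_le[OF add_mono[OF B A]])
      also have "\<dots> \<le> (e/2) * norm h + (e/2) * norm h"
        using le[of 0] le_j insert.prems by (intro add_mono mult_left_mono) auto
      finally show ?thesis
        by simp
    qed
    then show ?case
      using d1(1) d2(1) d3(1) by (intro exI[of _ "Min {d1, d2, d3}"]) auto
  qed
  have "\<exists>\<delta>>0. \<forall>y. norm (y - x) < \<delta> \<longrightarrow>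
          norm (f y - f x - (\<Sum>i\<in>UNIV. (y - x) $ i *\<^sub>R f' i x)) \<le> e * norm (y - x)" if e: "e > 0" for e
  proof -
    obtain d where d: "d > 0" "\<And>h. norm h < d \<Longrightarrow>
          norm (f (x + h) - f x - (\<Sum>i\<in>UNIV. h $ i *\<^sub>R f' i x)) \<le> e * norm h"
      using part[OF e, of UNIV] by auto
    have "norm (f y - f x - (\<Sum>i\<in>UNIV. (y - x) $ i *\<^sub>R f' i x)) \<le> e * norm (y - x)"
      if "norm (y - x) < d" for y
      using d(2)[OF that] by (simp only: add_diff_cancel_left' add.commute[of x] diff_add_cancel)
    then show ?thesis
      using d(1) by blast
  qed
  moreover have "bounded_linear (\<lambda>h. \<Sum>i\<in>UNIV. h $ i *\<^sub>R f' i x)"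
    by (intro bounded_linear_sum bounded_linear_compose[OF bounded_linear_scaleR_left bounded_linear_vec_nth])
  ultimately show ?thesis
    by (auto simp: has_derivative_at_alt)
qed

lemma Ck_has_derivative:
  assumes "open S" "x \<in> S" "Ck (Suc 0) S f"
  shows "(f has_derivative (\<lambda>h. \<Sum>i\<in>UNIV. h $ i *\<^sub>R pd f i x)) (at x)"
  using assms by (intro has_derivative_partials[OF assms(1,2)]) (auto simp: Ck_Suc)

lemma Ck_compose:
  fixes f :: "real^'m \<Rightarrow> 'b::real_normed_vector" and g :: "real^'n \<Rightarrow> real^'m"
  assumes "open S" "open T" "g ` S \<subseteq> T"
  shows "Ck n T f \<Longrightarrow> Ck n S g \<Longrightarrow> Ck n S (\<lambda>x. f (g x))"
proof (induction n arbitrary: f)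
  case 0
  then show ?case
    using assms(3) by (auto intro: continuous_on_compose2[of T f S g])
next
  case (Suc n)
  show ?case
  proof (rule Ck_SucI[where g="\<lambda>i x. \<Sum>j\<in>UNIV. pd g i x $ j *\<^sub>R pd f j (g x)", OF assms(1)])
    show "continuous_on S (\<lambda>x. f (g x))"
      using Suc.prems[THEN Ck_continuous] assms(3) by (auto intro: continuous_on_compose2[of T f S g])
    show "has_pd (\<lambda>x. f (g x)) (\<Sum>j\<in>UNIV. pd g i x $ j *\<^sub>R pd f j (g x)) i x" if "x \<in> S" for i x
    proof (rule has_pd_compose[where f'="\<lambda>h. \<Sum>j\<in>UNIV. h $ j *\<^sub>R pd f j (g x)"])
      show "has_pd g (pd g i x) i x"
        using Suc.prems that by (simp add: Ck_Suc)
      show "(f has_derivative (\<lambda>h. \<Sum>j\<in>UNIV. h $ j *\<^sub>R pd f j (g x))) (at (g x))"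
        using Ck_has_derivative[OF assms(2) _ Ck_mono[OF Suc.prems(1), of "Suc 0"]] that assms(3) by auto
    qed
    show "Ck n S (\<lambda>x. \<Sum>j\<in>UNIV. pd g i x $ j *\<^sub>R pd f j (g x))" for i
      using Suc.prems(1) Ck_Suc_imp[OF Suc.prems(2)] Suc.prems(2)
      by (intro Ck_sum Ck_scaleR Ck_vec_nth Suc.IH assms(1)) (auto simp: Ck_Suc)
  qed
qed

text \<open>The second difference of f over a small square is symmetric in the two axes. Two mean
  value theorems express it as u^2 times either mixed derivative at a nearby point, and continuity
  moves both points to x.\<close>

lemma pd_commute_real:
  fixes f :: "real^'n \<Rightarrow> real"
  assumes "open S" "x \<in> S" "Ck (Suc (Suc 0)) S f"
  shows "pd (pd f i) j x = pd (pd f j) i x"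
proof -
  have hp: "has_pd f (pd f i y) i y" if "y \<in> S" for i y
    using assms(3) that by (simp add: Ck_Suc)
  have hpp: "has_pd (pd f i) (pd (pd f i) j y) j y" if "y \<in> S" for i j y
    using assms(3) that by (simp add: Ck_Suc)
  obtain r where r: "r > 0" "ball x r \<subseteq> S"
    using assms(1,2) open_contains_ball by blast
  define P where "P = (\<lambda>i j s t. x + s *\<^sub>R axis i 1 + t *\<^sub>R axis j (1::real))"
  have P_dist: "dist (P i j s t) x \<le> \<bar>s\<bar> + \<bar>t\<bar>" for i j s t
    unfolding P_def dist_norm using norm_triangle_ineq[of "s *\<^sub>R axis i (1::real)" "t *\<^sub>R axis j (1::real)"]
    by (simp add: norm_axis_1)
  have P_swap: "P i j s t = P j i t s" for i j s t
    by (simp add: P_def algebra_simps)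
  have ex: "\<exists>s t. 0 < s \<and> s < u \<and> 0 < t \<and> t < u \<and>
      f (P i j u u) - f (P i j 0 u) - f (P i j u 0) + f (P i j 0 0) = u * u * pd (pd f i) j (P i j s t)"
    if u: "0 < u" "2 * u < r" for u i j
  proof -
    have inS: "P i j s t \<in> S" if "0 \<le> s" "s \<le> u" "0 \<le> t" "t \<le> u" for s t
      using P_dist[of i j s t] that u r(2) by (force simp: subset_eq dist_commute)
    have d1: "((\<lambda>s. f (P i j s t)) has_real_derivative pd f i (P i j s t)) (at s)"
      if "0 \<le> s" "s \<le> u" "0 \<le> t" "t \<le> u" for s t
      using has_pd_line[of f _ i "x + t *\<^sub>R axis j 1" s] hp[OF inS[OF that], of i]
      by (simp add: P_def has_real_derivative_iff_has_vector_derivative algebra_simps)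
    have d2: "((\<lambda>t. pd f i (P i j s t)) has_real_derivative pd (pd f i) j (P i j s t)) (at t)"
      if "0 \<le> s" "s \<le> u" "0 \<le> t" "t \<le> u" for s t
      using has_pd_line[of "pd f i" _ j "x + s *\<^sub>R axis i 1" t] hpp[OF inS[OF that], of i j]
      by (simp add: P_def has_real_derivative_iff_has_vector_derivative)
    have "((\<lambda>s. f (P i j s u) - f (P i j s 0)) has_real_derivative
        pd f i (P i j s u) - pd f i (P i j s 0)) (at s)" if "0 \<le> s" "s \<le> u" for s
      using that u by (intro DERIV_diff d1) auto
    from MVT2[OF u(1) this] obtain s where s: "0 < s" "s < u"
      "(f (P i j u u) - f (P i j u 0)) - (f (P i j 0 u) - f (P i j 0 0))
        = (u - 0) * (pd f i (P i j s u) - pd f i (P i j s 0))"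
      by blast
    obtain t where t: "0 < t" "t < u" "pd f i (P i j s u) - pd f i (P i j s 0) = (u - 0) * pd (pd f i) j (P i j s t)"
      using MVT2[OF u(1), of "\<lambda>t. pd f i (P i j s t)" "\<lambda>t. pd (pd f i) j (P i j s t)"] u d2 s by auto
    show ?thesis
      using s t by (intro exI[of _ s] exI[of _ t]) (simp add: algebra_simps)
  qed
  have "\<bar>pd (pd f i) j x - pd (pd f j) i x\<bar> < e" if "e > 0" for e
  proof -
    have cont: "\<exists>d>0. \<forall>y\<in>S. dist y x < d \<longrightarrow> dist (pd (pd f i) j y) (pd (pd f i) j x) < e/2" for i j
    proof -
      have "continuous_on S (pd (pd f i) j)"
        using assms(3) by (auto simp: Ck_Suc)
      then show ?thesis
        using assms(2) that unfolding continuous_on_iff by (meson half_gt_zero)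
    qed
    obtain d1 where d1: "d1 > 0" "\<And>y. y \<in> S \<Longrightarrow> dist y x < d1 \<Longrightarrow> dist (pd (pd f i) j y) (pd (pd f i) j x) < e/2"
      using cont by blast
    obtain d2 where d2: "d2 > 0" "\<And>y. y \<in> S \<Longrightarrow> dist y x < d2 \<Longrightarrow> dist (pd (pd f j) i y) (pd (pd f j) i x) < e/2"
      using cont by blast
    \<comment> \<open>The intermediate points lie within s + t < 2u of x; dividing by 3 makes 2u
      smaller than all three radii.\<close>
    define u where "u = Min {d1, d2, r} / 3"
    have u: "0 < u" "2 * u < r" "2 * u < d1" "2 * u < d2"
      using d1(1) d2(1) r(1) by (auto simp: u_def)
    obtain s t where st: "0 < s" "s < u" "0 < t" "t < u"
      "f (P i j u u) - f (P i j 0 u) - f (P i j u 0) + f (P i j 0 0) = u * u * pd (pd f i) j (P i j s t)"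
      using ex[OF u(1,2)] by blast
    obtain s' t' where st': "0 < s'" "s' < u" "0 < t'" "t' < u"
      "f (P j i u u) - f (P j i 0 u) - f (P j i u 0) + f (P j i 0 0) = u * u * pd (pd f j) i (P j i s' t')"
      using ex[OF u(1,2)] by blast
    have "u * u * pd (pd f i) j (P i j s t) = u * u * pd (pd f j) i (P j i s' t')"
      using st(5) st'(5) unfolding P_swap[of j i] by linarith
    then have eq: "pd (pd f i) j (P i j s t) = pd (pd f j) i (P j i s' t')"
      using u(1) by simp
    have near: "P i j s t \<in> S \<and> dist (P i j s t) x < d" if "0 < s" "s < u" "0 < t" "t < u" "2 * u < d" for i j s t d
      using P_dist[of i j s t] that u r(2) by (force simp: subset_eq dist_commute)
    have "\<bar>pd (pd f i) j (P i j s t) - pd (pd f i) j x\<bar> < e/2"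
      using d1(2)[of "P i j s t"] near[of s t d1 i j] st u by (simp add: dist_real_def)
    moreover have "\<bar>pd (pd f j) i (P j i s' t') - pd (pd f j) i x\<bar> < e/2"
      using d2(2)[of "P j i s' t'"] near[of s' t' d2 j i] st' u by (simp add: dist_real_def)
    ultimately show ?thesis
      unfolding eq by arith
  qed
  \<comment> \<open>Taking the difference itself as e would give a number smaller than itself,
    unless it is 0.\<close>
  from this[of "\<bar>pd (pd f i) j x - pd (pd f j) i x\<bar>"] show ?thesis
    by fastforce
qed

lemma pd_vec_nth:
  assumes "has_pd f (pd f i x) i x"
  shows "pd f i x $ k = pd (\<lambda>y. f y $ k) i x"
  using has_pd_imp_pd[OF has_pd_vec_nth[OF assms, of k]] by simp

text \<open>Done componentwise, because the mean value theorem as an equality fails for vector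
  values.\<close>

lemma pd_commute:
  fixes f :: "real^'n \<Rightarrow> real^'m"
  assumes "open S" "x \<in> S" "Ck (Suc (Suc 0)) S f"
  shows "pd (pd f i) j x = pd (pd f j) i x"
proof -
  have "pd (pd f i) j x $ k = pd (pd (\<lambda>y. f y $ k) i) j x" for i j k
  proof -
    have "pd (pd f i) j x $ k = pd (\<lambda>y. pd f i y $ k) j x"
      using assms by (intro pd_vec_nth) (simp add: Ck_Suc)
    also have "\<dots> = pd (pd (\<lambda>y. f y $ k) i) j x"
      using assms by (intro pd_cong_open[OF assms(1,2)] pd_vec_nth) (simp add: Ck_Suc)
    finally show ?thesis .
  qed
  then show ?thesis
    using pd_commute_real[OF assms(1,2) Ck_vec_nth[OF assms(1,3)]] by (simp add: vec_eq_iff)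
qed

section \<open>Closed coframes and coordinates\<close>

text \<open>Continuity of f comes from the total derivative that the continuous partials provide;
  each higher order is then one step above the order of the partials.\<close>

lemma smooth_on_of_partials:
  assumes "open S" "\<And>i y. y \<in> S \<Longrightarrow> has_pd f (f' i y) i y" "\<And>i. smooth_on S (f' i)"
  shows "smooth_on S f"
proof -
  have cont: "continuous_on S (f' i)" for i
    using assms(3)[of i] Ck_continuous[of 0] unfolding smooth_on_def by blast
  have "(f has_derivative (\<lambda>h. \<Sum>i\<in>UNIV. h $ i *\<^sub>R f' i y)) (at y)" if "y \<in> S" for y
    using has_derivative_partials[OF assms(1) that assms(2) cont] .
  then have cf: "continuous_on S f"
    by (meson continuous_at_imp_continuous_on has_derivative_continuous)
  have "Ck n S f" for n
  proof (cases n)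
    case (Suc m)
    then show ?thesis
      using Ck_SucI[OF assms(1) cf assms(2)] assms(3) by (simp add: smooth_on_def)
  qed (simp add: cf)
  then show ?thesis
    by (simp add: smooth_on_def)
qed

text \<open>The primitive integrates the form over the segment from p to x. Differentiating under
  the integral and using closedness turns the integrand into the s-derivative of s w_i(p + s (x -
  p)), whose integral is w_i(x).\<close>

lemma poincare_ball:
  fixes w :: "'n::finite \<Rightarrow> real^'n \<Rightarrow> real"
  assumes w: "\<And>i. Ck (Suc 0) (ball p r) (w i)"
    and closed: "\<And>i j x. x \<in> ball p r \<Longrightarrow> pd (w i) j x = pd (w j) i x"
  obtains f where "f p = 0" "\<And>i x. x \<in> ball p r \<Longrightarrow> has_pd f (w i x) i x"
proof -
  define f where "f = (\<lambda>x. integral {0..1} (\<lambda>s. \<Sum>j\<in>UNIV. w j (p + s *\<^sub>R (x - p)) * (x - p) $ j))"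
  have inball: "p + s *\<^sub>R (x - p) \<in> ball p r" if "x \<in> ball p r" "0 \<le> s" "s \<le> 1" for x s
  proof -
    have "\<bar>s\<bar> * norm (x - p) \<le> norm (x - p)"
      using that by (intro mult_left_le_one_le) auto
    then show ?thesis
      using that by (simp add: dist_norm norm_minus_commute)
  qed
  have wc: "continuous_on (ball p r) (w i)" "continuous_on (ball p r) (pd (w i) j)" for i j
    using w[of i] by (auto simp: Ck_Suc)
  have wd: "(w i has_derivative (\<lambda>h. \<Sum>j\<in>UNIV. h $ j *\<^sub>R pd (w i) j x)) (at x)" if "x \<in> ball p r" for i x
    using Ck_has_derivative[OF open_ball that w] .
  have main: "has_pd f (w i x) i x" if x: "x \<in> ball p r" for i x
  proof -
    define e where "e = r - dist p x"
    have e: "e > 0"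
      using x by (simp add: e_def)
    define c where "c = (\<lambda>u::real. x + u *\<^sub>R axis i 1)"
    have cin: "c u \<in> ball p r" if "u \<in> ball 0 e" for u
    proof -
      have "dist p (c u) \<le> dist p x + dist x (c u)"
        by (rule dist_triangle)
      then show ?thesis
        using that by (simp add: c_def e_def dist_norm norm_axis_1)
    qed
    define g where "g = (\<lambda>u s. \<Sum>j\<in>UNIV. w j (p + s *\<^sub>R (c u - p)) * (c u - p) $ j)"
    \<comment> \<open>The u-derivative of \<open>g\<close>, by the product rule: moving x along axis
      i by u moves the point p + s (x - p) by s u, whence the factor s.\<close>
    define g' where "g' = (\<lambda>u s. \<Sum>j\<in>UNIV. w j (p + s *\<^sub>R (c u - p)) * (axis i 1 $ j) +
        (s * pd (w j) i (p + s *\<^sub>R (c u - p))) * (c u - p) $ j)"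
    have dg: "((\<lambda>u. g u s) has_vector_derivative g' u s) (at u within ball 0 e)"
      if "u \<in> ball 0 e" "s \<in> cbox 0 1" for u s
    proof -
      have "((\<lambda>u. w j (p + s *\<^sub>R (c u - p))) has_vector_derivative
          (\<Sum>l\<in>UNIV. (s *\<^sub>R axis i 1) $ l *\<^sub>R pd (w j) l (p + s *\<^sub>R (c u - p)))) (at u)" for j
      proof -
        have "((\<lambda>u. p + s *\<^sub>R (c u - p)) has_vector_derivative s *\<^sub>R axis i 1) (at u)"
          unfolding c_def by (auto intro!: derivative_eq_intros)
        moreover have "p + s *\<^sub>R (c u - p) \<in> ball p r"
          using that by (intro inball cin) auto
        ultimately show ?thesis
          by (rule has_vector_derivative_compose_has_derivative[OF _ wd])
      qed
      moreover have "(\<Sum>l\<in>UNIV. (s *\<^sub>R axis i 1) $ l *\<^sub>R pd (w j) l (p + s *\<^sub>R (c u - p)))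
          = s * pd (w j) i (p + s *\<^sub>R (c u - p))" for j
        by (simp add: axis_def if_distrib if_distribR sum.delta cong: if_cong)
      ultimately have 1: "((\<lambda>u. w j (p + s *\<^sub>R (c u - p))) has_vector_derivative
          s * pd (w j) i (p + s *\<^sub>R (c u - p))) (at u)" for j
        by simp
      have 2: "((\<lambda>u. (c u - p) $ j) has_vector_derivative axis i 1 $ j) (at u)" for j
        unfolding c_def by (auto intro!: derivative_eq_intros)
      show ?thesis
        unfolding g_def g'_def
        by (rule has_vector_derivative_at_within[OF has_vector_derivative_sum[OF has_vector_derivative_mult[OF 1 2]]])
    qed
    have contg: "continuous_on A (\<lambda>z. F (p + snd z *\<^sub>R (c (fst z) - p)))"
      if "continuous_on (ball p r) F" "A \<subseteq> ball 0 e \<times> cbox 0 1" for F :: "_ \<Rightarrow> real" and A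
    proof (rule continuous_on_compose2[OF that(1)])
      show "continuous_on A (\<lambda>z. p + snd z *\<^sub>R (c (fst z) - p))"
        unfolding c_def by (intro continuous_intros)
      show "(\<lambda>z. p + snd z *\<^sub>R (c (fst z) - p)) ` A \<subseteq> ball p r"
        using that(2) inball cin by force
    qed
    have cont_g: "continuous_on (cbox 0 1) (g u)" if "u \<in> ball 0 e" for u
    proof -
      have "continuous_on (cbox 0 1) (\<lambda>s. w j (p + s *\<^sub>R (c u - p)))" for j
        using that inball[OF cin[OF that]]
        by (intro continuous_on_compose2[OF wc(1)] continuous_intros) auto
      then show ?thesis
        unfolding g_def by (intro continuous_intros)
    qed
    have "((\<lambda>u. integral (cbox 0 1) (g u)) has_vector_derivative integral (cbox 0 1) (g' 0)) (at 0 within ball 0 e)"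
    proof (rule leibniz_rule_vector_derivative)
      show "g u integrable_on cbox 0 1" if "u \<in> ball 0 e" for u
        by (rule integrable_continuous[OF cont_g[OF that]])
      show "continuous_on (ball 0 e \<times> cbox 0 1) (\<lambda>(u, s). g' u s)"
        unfolding g'_def case_prod_beta
        by (intro continuous_on_sum continuous_on_add continuous_on_mult contg wc)
          (auto simp: c_def intro!: continuous_intros)
    qed (use e dg in auto)
    moreover have "at (0::real) within ball 0 e = at 0"
      using e by (intro at_within_open) auto
    moreover have "(\<lambda>u. integral (cbox 0 1) (g u)) = (\<lambda>u. f (x + u *\<^sub>R axis i 1))"
      by (simp add: f_def g_def c_def)
    ultimately have hp: "has_pd f (integral (cbox 0 1) (g' 0)) i x"
      by (simp add: has_pd_def)
    have "((\<lambda>s. s * w i (p + s *\<^sub>R (x - p))) has_vector_derivative g' 0 s) (at s within {0..1})"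
      if s: "s \<in> {0..1}" for s
    proof -
      have y: "p + s *\<^sub>R (x - p) \<in> ball p r"
        using s by (intro inball x) auto
      have "((\<lambda>s. p + s *\<^sub>R (x - p)) has_vector_derivative (x - p)) (at s)"
        by (auto intro!: derivative_eq_intros)
      then have "((\<lambda>s. w i (p + s *\<^sub>R (x - p))) has_vector_derivative
          (\<Sum>j\<in>UNIV. (x - p) $ j *\<^sub>R pd (w i) j (p + s *\<^sub>R (x - p)))) (at s)"
        by (rule has_vector_derivative_compose_has_derivative) (rule wd[OF y])
      from has_vector_derivative_mult[OF has_vector_derivative_id this]
      have "((\<lambda>s. s * w i (p + s *\<^sub>R (x - p))) has_vector_derivative
          s * (\<Sum>j\<in>UNIV. (x - p) $ j *\<^sub>R pd (w i) j (p + s *\<^sub>R (x - p))) + w i (p + s *\<^sub>R (x - p))) (at s)"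
        by simp
      \<comment> \<open>Closedness swaps the two indices of \<open>pd (w i) j\<close>, which
        identifies the derivative along the ray with the Leibniz integrand.\<close>
      moreover have "s * (\<Sum>j\<in>UNIV. (x - p) $ j *\<^sub>R pd (w i) j (p + s *\<^sub>R (x - p))) + w i (p + s *\<^sub>R (x - p)) = g' 0 s"
      proof -
        define z where "z = p + s *\<^sub>R (x - p)"
        have "(\<Sum>j\<in>UNIV. w j z * axis i 1 $ j) = w i z"
          by (simp add: axis_def if_distrib cong: if_cong)
        then show ?thesis
          using closed[OF y, of i]
          by (simp add: g'_def c_def sum.distrib sum_distrib_left mult_ac flip: z_def)
      qed
      ultimately show ?thesis
        by (simp add: has_vector_derivative_at_within)
    qed
    from fundamental_theorem_of_calculus[OF _ this]
    have "(g' 0 has_integral w i x) {0..1}"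
      by simp
    then show ?thesis
      using hp by (simp add: integral_unique)
  qed
  show thesis
    by (rule that[of f]) (use main in \<open>auto simp: f_def\<close>)
qed

text \<open>Primitives of the closed forms are the components of a map \<open>\<Phi>\<close> whose
  Jacobian \<open>W\<close> is inverted by the matrix of the dual frame, so the inverse function
  theorem applies. The Jacobian of the local inverse is that frame matrix: each E_a becomes a
  coordinate field.\<close>

lemma coordinates_of_closed_coframe:
  fixes E w :: "'n::finite \<Rightarrow> real^'n \<Rightarrow> real^'n"
  assumes U: "open U" "p \<in> U"
    and smE: "\<And>a. smooth_on U (E a)" and smw: "\<And>a. smooth_on U (w a)"
    and dual: "\<And>a b x. x \<in> U \<Longrightarrow> w a x \<bullet> E b x = (if a = b then 1 else 0)"
    and closed: "\<And>a i j x. x \<in> U \<Longrightarrow> pd (\<lambda>y. w a y $ i) j x = pd (\<lambda>y. w a y $ j) i x"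
  obtains r Nb psi psi' where "0 < r" "open Nb" "p \<in> Nb" "Nb \<subseteq> U"
    "smooth_on (ball 0 r) psi" "smooth_on Nb psi'" "psi ` ball 0 r = Nb" "psi' ` Nb = ball 0 r"
    "\<forall>x\<in>ball 0 r. psi' (psi x) = x" "\<forall>y\<in>Nb. psi (psi' y) = y"
    "\<forall>x\<in>ball 0 r. \<forall>a. has_pd psi (E a (psi x)) a x"
proof -
  obtain R where R: "R > 0" "ball p R \<subseteq> U"
    using U open_contains_ball by blast
  let ?B = "ball p R"
  have smw_nth: "Ck n U (\<lambda>x. w a x $ i)" for n a i
    using smw by (intro Ck_vec_nth U) (simp add: smooth_on_def)
  have "\<exists>f. f p = 0 \<and> (\<forall>i. \<forall>x\<in>?B. has_pd f (w a x $ i) i x)" for a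
  proof -
    obtain f where "f p = 0" "\<And>i x. x \<in> ?B \<Longrightarrow> has_pd f (w a x $ i) i x"
      using poincare_ball[of p R "\<lambda>i x. w a x $ i"] closed[of _ a] Ck_subset[OF smw_nth R(2)] R(2) by blast
    then show ?thesis
      by blast
  qed
  then obtain f where f0: "\<And>a. f a p = 0" and f: "\<And>a i x. x \<in> ?B \<Longrightarrow> has_pd (f a) (w a x $ i) i x"
    by metis
  define \<Phi> where "\<Phi> = (\<lambda>x. \<chi> a. f a x)"
  define W where "W = (\<lambda>x. \<chi> a. w a x)"
  define M where "M = (\<lambda>x. \<chi> i a. E a x $ i)"
  have "W x ** M x = mat 1" if "x \<in> U" for x
    using dual[OF that]
    by (simp add: vec_eq_iff W_def M_def matrix_matrix_mult_def inner_vec_def mat_def)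
  then have WM: "W x ** M x = mat 1" "M x ** W x = mat 1" if "x \<in> U" for x
    using that matrix_left_right_inverse by blast+
  have WMv: "W x *v (M x *v y) = y" "M x *v (W x *v y) = y" if "x \<in> U" for x y
    using WM[OF that] by (simp_all add: matrix_vector_mul_assoc)
  have Mv: "M x *v axis a 1 = E a x" for x a
    by (simp add: matrix_vector_mult_basis column_def M_def vec_eq_iff)
  have sm_col: "smooth_on ?B (\<lambda>x. \<chi> a. w a x $ i)" for i
    unfolding smooth_on_def using Ck_subset[OF smw_nth R(2)] by (auto intro!: Ck_vec)
  have pd\<Phi>: "has_pd \<Phi> (\<chi> a. w a x $ i) i x" if "x \<in> ?B" for x i
  proof -
    have "has_pd (\<lambda>x. \<Sum>a\<in>UNIV. f a x *\<^sub>R (axis a 1 :: real^'n))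
        (\<Sum>a\<in>UNIV. f a x *\<^sub>R 0 + (w a x $ i) *\<^sub>R axis a 1) i x"
      by (intro has_pd_sum has_pd_scaleR f that has_pd_const)
    moreover have "(\<Sum>a\<in>UNIV. v a *\<^sub>R (axis a 1 :: real^'n)) = (\<chi> a. v a)" for v
      using basis_expansion[of "\<chi> a. v a"] by (simp add: scalar_mult_eq_scaleR)
    ultimately show ?thesis
      by (simp add: \<Phi>_def)
  qed
  have sm\<Phi>: "smooth_on ?B \<Phi>"
    by (rule smooth_on_of_partials[OF open_ball pd\<Phi> sm_col])
  have "(\<Phi> has_derivative (\<lambda>h. \<Sum>i\<in>UNIV. h $ i *\<^sub>R (\<chi> a. w a x $ i))) (at x)" if "x \<in> ?B" for x
    using sm_col Ck_continuous unfolding smooth_on_def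
    by (intro has_derivative_partials[OF open_ball that pd\<Phi>]) blast+
  moreover have "(\<Sum>i\<in>UNIV. h $ i *\<^sub>R (\<chi> a. w a x $ i)) = W x *v h" for x h
    by (simp add: vec_eq_iff W_def matrix_vector_mult_def mult.commute)
  ultimately have der\<Phi>: "(\<Phi> has_derivative blinfun_apply (Blinfun ((*v) (W x)))) (at x)" if "x \<in> ?B" for x
    using that by (simp add: bounded_linear_Blinfun_apply matrix_vector_mul_bounded_linear)
  obtain U' V g g' where IFT: "open U'" "U' \<subseteq> ?B" "p \<in> U'" "open V" "\<Phi> p \<in> V" "homeomorphism U' V \<Phi> g"
    "\<And>y. y \<in> V \<Longrightarrow> (g has_derivative (g' y)) (at y)"
    "\<And>y. y \<in> V \<Longrightarrow> g' y = inv_into UNIV (blinfun_apply (Blinfun ((*v) (W (g y)))))"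
  proof (rule inverse_function_theorem[OF open_ball der\<Phi>])
    show "continuous_on ?B (\<lambda>x. Blinfun ((*v) (W x)))"
    proof (rule continuous_on_blinfun_componentwise)
      fix b :: "real^'n"
      have "continuous_on ?B (\<lambda>x. W x *v b)"
        unfolding W_def matrix_vector_mult_def vec_lambda_beta
        by (intro continuous_on_vec_lambda continuous_on_sum continuous_on_mult continuous_on_const
            Ck_continuous[OF Ck_subset[OF smw_nth R(2)]])
      then show "continuous_on ?B (\<lambda>x. blinfun_apply (Blinfun ((*v) (W x))) b)"
        by (simp add: bounded_linear_Blinfun_apply matrix_vector_mul_bounded_linear)
    qed
    show "Blinfun ((*v) (M p)) o\<^sub>L Blinfun ((*v) (W p)) = id_blinfun"
      using WMv[OF U(2)]
      by (intro blinfun_eqI) (simp add: bounded_linear_Blinfun_apply matrix_vector_mul_bounded_linear)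
  qed (use R in auto)
  have hom: "g ` V = U'" "\<Phi> ` U' = V" "\<And>x. x \<in> U' \<Longrightarrow> g (\<Phi> x) = x" "\<And>y. y \<in> V \<Longrightarrow> \<Phi> (g y) = y"
    "continuous_on U' \<Phi>"
    using IFT(6) by (auto simp: homeomorphism_def)
  have "\<Phi> p = 0"
    by (simp add: \<Phi>_def f0 vec_eq_iff)
  then obtain r where r: "r > 0" "ball 0 r \<subseteq> V"
    using IFT(4,5) open_contains_ball by metis
  \<comment> \<open>The coordinate domain is cut down to a ball around 0. Setting a coordinate to
    zero along a segment then never leaves the domain, which is used to show that k is independent
    of t.\<close>
  define Nb where "Nb = U' \<inter> \<Phi> -` ball 0 r"
  have gU: "g y \<in> U'" "g y \<in> ?B" "g y \<in> U" if "y \<in> ball 0 r" for y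
  proof -
    show "g y \<in> U'"
      unfolding hom(1)[symmetric] using that r(2) by (intro imageI) auto
    then show "g y \<in> ?B" "g y \<in> U"
      using IFT(2) R(2) by auto
  qed
  have pdg: "has_pd g (E a (g y)) a y" if "y \<in> ball 0 r" for a y
  proof -
    have y: "y \<in> V"
      using that r(2) by auto
    have "inv_into UNIV ((*v) (W (g y))) = (*v) (M (g y))"
      using WMv[OF gU(3)[OF that]] by (intro inv_equality) auto
    then have "g' y = (*v) (M (g y))"
      using IFT(8)[OF y] by (simp add: bounded_linear_Blinfun_apply matrix_vector_mul_bounded_linear)
    then show ?thesis
      using has_derivative_imp_has_pd[OF IFT(7)[OF y], of a] by (simp add: Mv)
  qed
  have contg: "continuous_on (ball 0 r) g"
    using IFT(6) r(2) by (auto simp: homeomorphism_def intro: continuous_on_subset)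
  \<comment> \<open>Bootstrap: the partials of g are the compositions of E_a with g, so if g is C^n
    they are C^n, and g is C^(n+1).\<close>
  have "Ck n (ball 0 r) g" for n
  proof (induction n)
    case (Suc n)
    show ?case
    proof (rule Ck_SucI[OF open_ball contg pdg])
      show "Ck n (ball 0 r) (\<lambda>y. E a (g y))" for a
        using smE gU by (intro Ck_compose[OF open_ball U(1) _ _ Suc]) (auto simp: smooth_on_def)
    qed
  qed (simp add: contg)
  then have smg: "smooth_on (ball 0 r) g"
    by (simp add: smooth_on_def)
  show thesis
  proof (rule that[of r Nb g \<Phi>])
    show "open Nb"
      unfolding Nb_def by (rule continuous_open_preimage[OF hom(5) IFT(1) open_ball])
    show "p \<in> Nb"
      using IFT(3) \<open>\<Phi> p = 0\<close> r(1) by (simp add: Nb_def)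
    show "Nb \<subseteq> U"
      using IFT(2) R(2) by (auto simp: Nb_def)
    show "smooth_on Nb \<Phi>"
      using sm\<Phi> Ck_subset[of _ ?B \<Phi> Nb] IFT(2) by (auto simp: smooth_on_def Nb_def)
    show "g ` ball 0 r = Nb"
    proof (intro equalityI subsetI)
      fix x assume "x \<in> Nb"
      then have "x = g (\<Phi> x)" "\<Phi> x \<in> ball 0 r"
        using hom(3) by (auto simp: Nb_def)
      then show "x \<in> g ` ball 0 r"
        by blast
    next
      fix x assume "x \<in> g ` ball 0 r"
      then obtain y where "x = g y" "y \<in> ball 0 r"
        by blast
      then show "x \<in> Nb"
        using gU hom(4)[of y] r(2) by (auto simp: Nb_def)
    qed
    show "\<Phi> ` Nb = ball 0 r"
    proof (intro equalityI subsetI)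
      fix y :: "real^'n" assume y: "y \<in> ball 0 r"
      then have "\<Phi> (g y) = y"
        using hom(4) r(2) by auto
      moreover from this have "g y \<in> Nb"
        using gU y by (simp add: Nb_def)
      ultimately show "y \<in> \<Phi> ` Nb"
        by (metis image_eqI)
    qed (auto simp: Nb_def)
    show "\<forall>x\<in>ball 0 r. \<Phi> (g x) = x"
      using r(2) hom(4) by auto
    show "\<forall>y\<in>Nb. g (\<Phi> y) = y"
      using hom(3) by (auto simp: Nb_def)
  qed (use r smg pdg in auto)
qed

section \<open>Improper affine hyperspheres\<close>

text \<open>The curvature of the connection matrix vanishes because second derivatives commute.\<close>

lemma frame_structure_equation:
  fixes E :: "'a::finite \<Rightarrow> real^'n \<Rightarrow> real^'m" and \<Omega> :: "'n \<Rightarrow> real^'n \<Rightarrow> real^'a^'a"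
  assumes S: "open S" "p \<in> S"
    and dE: "\<And>a i q. q \<in> S \<Longrightarrow> has_pd (E a) (\<Sum>b\<in>UNIV. \<Omega> i q $ a $ b *\<^sub>R E b q) i q"
    and sm: "\<And>a b i. Ck (Suc 0) S (\<lambda>q. \<Omega> i q $ a $ b)" "\<And>a. Ck 0 S (E a)"
    and indep: "\<And>c. (\<Sum>b\<in>UNIV. c b *\<^sub>R E b p) = 0 \<Longrightarrow> \<forall>b. c b = 0"
  shows "pd (\<lambda>q. \<Omega> i q $ a $ c) j p + (\<Omega> i p ** \<Omega> j p) $ a $ c
       = pd (\<lambda>q. \<Omega> j q $ a $ c) i p + (\<Omega> j p ** \<Omega> i p) $ a $ c"
proof -
  have pdE: "pd (E a) i q = (\<Sum>b\<in>UNIV. \<Omega> i q $ a $ b *\<^sub>R E b q)" if "q \<in> S" for a i q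
    using has_pd_imp_pd[OF dE[OF that]] .
  \<comment> \<open>The frame solves a linear first-order system with C^1 coefficients. This lifts
    it from continuous to C^1 and then to C^2, enough for its second derivatives to commute.\<close>
  have E1: "Ck (Suc 0) S (E a)" for a
    by (intro Ck_SucI[OF S(1) Ck_continuous[OF sm(2)] dE] Ck_sum Ck_scaleR S(1) sm(1)[THEN Ck_Suc_imp] sm(2))
  have E2: "Ck (Suc (Suc 0)) S (E a)" for a
    by (intro Ck_SucI[OF S(1) Ck_continuous[OF sm(2)] dE] Ck_sum Ck_scaleR S(1) sm(1) E1)
  \<comment> \<open>The coefficient of E_c after differentiating E_a along axis i and then along
    axis j.\<close>
  define H where "H = (\<lambda>i j c. pd (\<lambda>q. \<Omega> i q $ a $ c) j p + (\<Omega> i p ** \<Omega> j p) $ a $ c)"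
  have H: "pd (pd (E a) i) j p = (\<Sum>c\<in>UNIV. H i j c *\<^sub>R E c p)" for i j
  proof -
    have "has_pd (\<lambda>q. \<Sum>b\<in>UNIV. \<Omega> i q $ a $ b *\<^sub>R E b q)
        (\<Sum>b\<in>UNIV. \<Omega> i p $ a $ b *\<^sub>R (\<Sum>c\<in>UNIV. \<Omega> j p $ b $ c *\<^sub>R E c p)
            + pd (\<lambda>q. \<Omega> i q $ a $ b) j p *\<^sub>R E b p) j p"
      using sm(1) S(2) by (intro has_pd_sum has_pd_scaleR dE) (auto simp: Ck_Suc)
    from has_pd_imp_pd[OF this] have "pd (pd (E a) i) j p =
        (\<Sum>b\<in>UNIV. \<Omega> i p $ a $ b *\<^sub>R (\<Sum>c\<in>UNIV. \<Omega> j p $ b $ c *\<^sub>R E c p)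
            + pd (\<lambda>q. \<Omega> i q $ a $ b) j p *\<^sub>R E b p)"
      using pd_cong_open[OF S, of "pd (E a) i"] pdE by simp
    also have "\<dots> = (\<Sum>c\<in>UNIV. H i j c *\<^sub>R E c p)"
    proof -
      have "(\<Sum>b\<in>UNIV. \<Omega> i p $ a $ b *\<^sub>R (\<Sum>c\<in>UNIV. \<Omega> j p $ b $ c *\<^sub>R E c p))
          = (\<Sum>c\<in>UNIV. (\<Sum>b\<in>UNIV. \<Omega> i p $ a $ b * \<Omega> j p $ b $ c) *\<^sub>R E c p)"
        by (simp add: scaleR_sum_right scaleR_sum_left) (rule sum.swap)
      then show ?thesis
        by (simp add: H_def sum.distrib scaleR_add_left matrix_matrix_mult_def)
    qed
    finally show ?thesis .
  qed
  have "(\<Sum>c\<in>UNIV. (H i j c - H j i c) *\<^sub>R E c p) = 0"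
    using pd_commute[OF S E2, of a i j] H by (simp add: scaleR_diff_left sum_subtractf)
  from indep[OF this] show ?thesis
    by (simp add: H_def)
qed

lemma basis_expansion_scaleR: "(\<Sum>i\<in>UNIV. v $ i *\<^sub>R axis i 1) = (v :: real^'n)"
  using basis_expansion[of v] by (simp add: scalar_mult_eq_scaleR)

lemma sum_axis_mult: "(\<Sum>j\<in>UNIV. axis i 1 $ j * F j) = (F i :: real)"
proof -
  have "(\<Sum>j\<in>UNIV. axis i 1 $ j * F j) = (\<Sum>j\<in>UNIV. if j = i then F j else 0)"
    by (intro sum.cong) (auto simp: axis_def)
  then show ?thesis
    by simp
qed

section \<open>Metric, connections and difference tensor of the hypersurface\<close>

locale improper_hypersphere =
  fixes U :: "(real^3) set" and phi xi :: "real^3 \<Rightarrow> real^4"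
  assumes hs: "improper_affine_hypersphere U phi xi"
    and lorentz: "\<forall>p\<in>U. lorentzian (aff_metric phi xi p)"
begin

abbreviation "g \<equiv> aff_metric phi xi"
abbreviation "h \<equiv> hform phi xi"
abbreviation "K \<equiv> diff_tensor phi xi"
abbreviation "dg l a b p \<equiv> pd (\<lambda>q. g q $ a $ b) l p"
abbreviation "frame \<equiv> frame_mat phi xi"
abbreviation "Gam p k i j \<equiv> ind_conn phi xi p k i j"
abbreviation "lc p k i j \<equiv> lc_conn phi xi p k i j"

lemma blaschke: "blaschke_hypersurface U phi xi"
  using hs by (simp add: improper_affine_hypersphere_def)

lemma open_U: "open U"
  and Ck_phi: "Ck n U phi"
  and Ck_xi: "Ck n U xi"
  and det_frame: "p \<in> U \<Longrightarrow> det (frame p) \<noteq> 0"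
  and det_g: "p \<in> U \<Longrightarrow> det (g p) \<noteq> 0"
  using blaschke unfolding blaschke_hypersurface_def smooth_on_def by blast+

lemma g_sym:
  assumes "p \<in> U"
  shows "g p $ i $ j = g p $ j $ i"
proof -
  have "g p = transpose (g p)"
    using lorentz assms unfolding lorentzian_def by blast
  then have "g p $ i $ j = transpose (g p) $ i $ j"
    by (rule arg_cong)
  then show ?thesis
    by (simp add: transpose_def)
qed

lemma dg_sym: "p \<in> U \<Longrightarrow> dg l i j p = dg l j i p"
  by (rule pd_cong_open[OF open_U]) (auto simp: g_sym)

lemma frame_decomposition:
  assumes "p \<in> U"
  shows "v = (\<Sum>k\<in>UNIV. coef phi xi p v $ emb34 k *\<^sub>R pd phi k p) + coef phi xi p v $ 4 *\<^sub>R xi p"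
proof -
  have "v = frame p *v coef phi xi p v"
    by (simp add: coef_def matrix_inv_mult_vector[OF det_frame[OF assms]])
  then show ?thesis
    by (simp add: vec_eq_iff matrix_vector_mult_def frame_mat_def sum_3 sum_4 emb34_def mult.commute)
qed

lemma frame_independent:
  assumes "p \<in> U" "(\<Sum>k\<in>UNIV. u $ k *\<^sub>R pd phi k p) + c *\<^sub>R xi p = 0"
  shows "u = 0" "c = 0"
proof -
  define v :: "real^4" where "v = (\<chi> b. if b = 1 then u $ 1 else if b = 2 then u $ 2 else if b = 3 then u $ 3 else c)"
  have "frame p *v v = 0"
    using assms(2)
    by (simp add: vec_eq_iff matrix_vector_mult_def frame_mat_def sum_3 sum_4 v_def mult.commute)
  then have "v = 0"
    using matrix_inv_mult_vector(2)[OF det_frame[OF assms(1)], of v] by simp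
  then have "v $ 1 = 0" "v $ 2 = 0" "v $ 3 = 0" "v $ 4 = 0"
    by simp_all
  then show "u = 0" "c = 0"
    by (simp_all add: v_def vec_eq_iff forall_3)
qed

text \<open>S = 0 removes the tangential part of the derivative of xi, and the equiaffine condition
  of the Blaschke structure removes the transversal part.\<close>

lemma has_pd_xi: "p \<in> U \<Longrightarrow> has_pd xi 0 i p"
proof -
  assume p: "p \<in> U"
  have "coef phi xi p (pd xi i p) $ emb34 k = 0" for k
  proof -
    have "shape_op phi xi p $ k $ i = 0"
      using hs p by (simp add: improper_affine_hypersphere_def)
    then show ?thesis
      by (simp add: shape_op_def)
  qed
  moreover have "coef phi xi p (pd xi i p) $ 4 = 0"
    using blaschke p unfolding blaschke_hypersurface_def by blast
  ultimately have "pd xi i p = 0"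
    using frame_decomposition[OF p, of "pd xi i p"] by simp
  then show ?thesis
    using Ck_xi[of "Suc 0"] p by (metis Ck_Suc)
qed

lemma gauss_formula:
  assumes "p \<in> U"
  shows "pd (pd phi j) i p = (\<Sum>k\<in>UNIV. Gam p k i j *\<^sub>R pd phi k p) + g p $ i $ j *\<^sub>R xi p"
  using frame_decomposition[OF assms, of "pd (pd phi j) i p"] by (simp add: ind_conn_def aff_metric_def)

lemma Gam_sym: "p \<in> U \<Longrightarrow> Gam p k i j = Gam p k j i"
  using pd_commute[OF open_U _ Ck_phi, of p j i] by (simp add: ind_conn_def)

lemma Ck_pd_phi: "Ck n U (pd phi i)"
  using Ck_phi[of "Suc n"] by (simp add: Ck_Suc)

lemma Ck_coef: "Ck n U (\<lambda>p. coef phi xi p (pd (pd phi j) i p) $ m)"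
proof -
  have "Ck n U (\<lambda>p. frame p $ r $ c)" for r c
    unfolding frame_mat_def using Ck_pd_phi Ck_xi
    by (cases "c = 1"; cases "c = 2"; cases "c = 3") (auto intro!: Ck_vec_nth open_U)
  moreover have "Ck n U (\<lambda>p. pd (pd phi j) i p $ r)" for r
    using Ck_pd_phi[of "Suc n" j] by (intro Ck_vec_nth open_U) (simp add: Ck_Suc)
  ultimately show ?thesis
    unfolding coef_def by (intro Ck_matrix_inv_vector open_U det_frame)
qed

lemma Ck_g: "Ck n U (\<lambda>p. g p $ i $ j)"
  using Ck_coef by (simp add: aff_metric_def)

lemma Ck_lc: "Ck n U (\<lambda>p. lc p k i j)"
proof -
  have "Ck n U (\<lambda>p. dg l a b p)" for l a b
    using Ck_g[of "Suc n" a b] by (simp add: Ck_Suc)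
  then show ?thesis
    unfolding lc_conn_def Let_def
    by (intro Ck_mult Ck_const Ck_sum Ck_diff Ck_add Ck_matrix_inv Ck_g det_g open_U)
qed

lemma lc_sym: "p \<in> U \<Longrightarrow> lc p k i j = lc p k j i"
  unfolding lc_conn_def Let_def using dg_sym by (simp add: add.commute)

text \<open>These are the Christoffel symbols of the first kind, free of the inverse metric; metric
  compatibility is computed with them.\<close>

lemma lc_lower:
  assumes "p \<in> U"
  shows "(\<Sum>m\<in>UNIV. g p $ k $ m * lc p m i j) = (1/2) * (dg i j k p + dg j i k p - dg k i j p)"
proof -
  define u :: "real^3" where "u = (\<chi> l. dg i j l p + dg j i l p - dg l i j p)"
  have "lc p m i j = (1/2) * (matrix_inv (g p) *v u) $ m" for m
    by (simp add: lc_conn_def Let_def u_def matrix_vector_mult_def)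
  then have "(\<Sum>m\<in>UNIV. g p $ k $ m * lc p m i j) = (1/2) * (g p *v (matrix_inv (g p) *v u)) $ k"
    by (simp only:) (simp add: matrix_vector_mult_def[of "g p"] sum_distrib_left mult_ac)
  then show ?thesis
    by (simp only: matrix_inv_mult_vector[OF det_g[OF assms]]) (simp add: u_def)
qed

text \<open>The Levi-Civita derivative along the i-th coordinate field. With coordinate directions a
  connection form is a family of functions indexed by i, and its exterior derivative is an
  antisymmetrised \<open>pd\<close>.\<close>

definition "lc_deriv Y i p = pd Y i p + (\<chi> k. \<Sum>j\<in>UNIV. lc p k i j * Y p $ j)"

lemma lc_cov_eq: "lc_cov phi xi p X Y = (\<Sum>i\<in>UNIV. X $ i *\<^sub>R lc_deriv Y i p)"
proof -
  have "(\<chi> k. \<Sum>i\<in>UNIV. \<Sum>j\<in>UNIV. X $ i * Y p $ j * lc p k i j)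
      = (\<Sum>i\<in>UNIV. X $ i *\<^sub>R (\<chi> k. \<Sum>j\<in>UNIV. lc p k i j * Y p $ j))"
    by (simp add: vec_eq_iff sum_distrib_left mult_ac)
  then show ?thesis
    by (simp add: lc_cov_def lc_deriv_def scaleR_add_right sum.distrib)
qed

lemma bilinear_h: "bounded_bilinear (h p)"
proof
  show "\<exists>C. \<forall>a b. norm (h p a b) \<le> norm a * norm b * C"
  proof -
    obtain C where "\<And>b. norm (g p *v b) \<le> norm b * C"
      using bounded_linear.bounded[OF matrix_vector_mul_bounded_linear[of "g p"]] by blast
    then have "norm (h p a b) \<le> norm a * norm b * C" for a b
      unfolding hform_def using Cauchy_Schwarz_ineq2[of a "g p *v b"]
      by (smt (verit) mult.assoc mult_left_mono norm_ge_zero real_norm_def)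
    then show ?thesis
      by blast
  qed
qed (simp_all add: hform_def inner_add_left inner_add_right matrix_vector_right_distrib matrix_vector_mult_scaleR)

lemma h_expand: "h p X Y = (\<Sum>j\<in>UNIV. \<Sum>k\<in>UNIV. X $ j * (g p $ j $ k * Y $ k))"
  by (simp add: hform_def inner_vec_def matrix_vector_mult_def sum_distrib_left)

lemma h_sym: "p \<in> U \<Longrightarrow> h p X Y = h p Y X"
  unfolding h_expand by (subst sum.swap) (simp add: g_sym mult_ac)

lemma metric_compatible:
  assumes p: "p \<in> U" and Y: "has_pd Y (pd Y i p) i p" and Z: "has_pd Z (pd Z i p) i p"
  shows "has_pd (\<lambda>q. h q (Y q) (Z q)) (h p (lc_deriv Y i p) (Z p) + h p (Y p) (lc_deriv Z i p)) i p"
proof -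
  interpret h: bounded_bilinear "h p"
    by (rule bilinear_h)
  have *: "has_pd (\<lambda>q. h q (Y q) (Z q)) (\<Sum>j\<in>UNIV. \<Sum>k\<in>UNIV.
      Y p $ j * (g p $ j $ k * pd Z i p $ k + dg i j k p * Z p $ k) + pd Y i p $ j * (g p $ j $ k * Z p $ k)) i p"
    unfolding h_expand using Ck_g[of "Suc 0"] p
    by (intro has_pd_sum has_pd_mult has_pd_vec_nth Y Z) (auto simp: Ck_Suc)
  have 1: "h p (\<chi> k. \<Sum>j\<in>UNIV. lc p k i j * Y p $ j) Z' =
      (\<Sum>j\<in>UNIV. \<Sum>k\<in>UNIV. Y p $ j * ((1/2) * (dg i j k p + dg j i k p - dg k i j p) * Z' $ k))" for Y Z'
  proof -
    have "h p (\<chi> k. \<Sum>j\<in>UNIV. lc p k i j * Y p $ j) Z' =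
        (\<Sum>j\<in>UNIV. \<Sum>k\<in>UNIV. Y p $ j * ((\<Sum>m\<in>UNIV. g p $ k $ m * lc p m i j) * Z' $ k))"
      by (simp add: h_expand sum_3 g_sym[OF p, of 2 1] g_sym[OF p, of 3 1] g_sym[OF p, of 3 2] algebra_simps)
    then show ?thesis
      unfolding lc_lower[OF p] .
  qed
  have "h p (lc_deriv Y i p) (Z p) + h p (Y p) (lc_deriv Z i p) =
      h p (pd Y i p) (Z p) + h p (Y p) (pd Z i p)
      + (h p (\<chi> k. \<Sum>j\<in>UNIV. lc p k i j * Y p $ j) (Z p) + h p (\<chi> k. \<Sum>j\<in>UNIV. lc p k i j * Z p $ j) (Y p))"
    by (simp add: lc_deriv_def h.add_left h.add_right h_sym[OF p, of "Y p" "\<chi> k. \<Sum>j\<in>UNIV. lc p k i j * Z p $ j"])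
  also have "h p (\<chi> k. \<Sum>j\<in>UNIV. lc p k i j * Y p $ j) (Z p) + h p (\<chi> k. \<Sum>j\<in>UNIV. lc p k i j * Z p $ j) (Y p)
     = (\<Sum>j\<in>UNIV. \<Sum>k\<in>UNIV. Y p $ j * (dg i j k p * Z p $ k))"
  proof -
    have "(\<Sum>j\<in>UNIV. \<Sum>k\<in>UNIV. Z p $ j * ((1/2) * (dg i j k p + dg j i k p - dg k i j p) * Y p $ k)) =
        (\<Sum>j\<in>UNIV. \<Sum>k\<in>UNIV. Z p $ k * ((1/2) * (dg i k j p + dg k i j p - dg j i k p) * Y p $ j))"
      by (rule sum.swap)
    \<comment> \<open>Two first-kind symbols with j and k exchanged add up to the i-th derivative of
      g_jk; the other terms cancel by symmetry of g.\<close>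
    moreover have *: "Y p $ j * ((1/2) * (dg i j k p + dg j i k p - dg k i j p) * Z p $ k)
        + Z p $ k * ((1/2) * (dg i k j p + dg k i j p - dg j i k p) * Y p $ j)
        = Y p $ j * (dg i j k p * Z p $ k)" for j k
      using dg_sym[OF p, of j k i] by (simp add: field_simps)
    ultimately show ?thesis
      unfolding 1 by (simp only: sum.distrib[symmetric] *)
  qed
  finally show ?thesis
    using * by (simp add: h_expand sum.distrib algebra_simps)
qed

text \<open>Both connections are torsion free.\<close>

lemma K_sym:
  assumes p: "p \<in> U"
  shows "K p X Y = K p Y X"
proof -
  have "(\<Sum>i\<in>UNIV. \<Sum>j\<in>UNIV. X $ i * Y $ j * (Gam p k i j - lc p k i j))
      = (\<Sum>i\<in>UNIV. \<Sum>j\<in>UNIV. Y $ i * X $ j * (Gam p k i j - lc p k i j))" for k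
    by (subst sum.swap, intro sum.cong refl) (simp add: Gam_sym[OF p, of k] lc_sym[OF p, of k])
  then show ?thesis
    by (simp add: diff_tensor_def)
qed

lemma K_linear: "linear (K p X)"
  by (rule linearI) (simp_all add: diff_tensor_def vec_eq_iff sum_3 algebra_simps)

definition "dphi p v = (\<Sum>j\<in>UNIV. v $ j *\<^sub>R pd phi j p)"

lemma linear_dphi: "linear (dphi p)"
  by (rule linearI) (simp_all add: dphi_def scaleR_add_left sum.distrib scaleR_sum_right)

text \<open>The Gauss formula, with the induced connection split into the Levi-Civita connection
  plus K. The split pays off on the orthonormal frame, where the first part has an h-skew matrix and
  the second an h-symmetric one.\<close>

lemma has_pd_dphi:
  assumes p: "p \<in> U" and Y: "has_pd Y (pd Y i p) i p"
  shows "has_pd (\<lambda>q. dphi q (Y q)) (dphi p (lc_deriv Y i p + K p (axis i 1) (Y p)) + h p (axis i 1) (Y p) *\<^sub>R xi p) i p"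
proof -
  have nab: "lc_deriv Y i p + K p (axis i 1) (Y p) = pd Y i p + (\<chi> k. \<Sum>j\<in>UNIV. Gam p k i j * Y p $ j)"
  proof -
    have "K p (axis i 1) (Y p) = (\<chi> k. \<Sum>j\<in>UNIV. (Gam p k i j - lc p k i j) * Y p $ j)"
      by (simp add: diff_tensor_def vec_eq_iff mult.assoc sum_distrib_left[symmetric] sum_axis_mult mult.commute[of "Y p $ _"])
    then show ?thesis
      by (simp add: lc_deriv_def vec_eq_iff algebra_simps sum.distrib sum_subtractf)
  qed
  have 1: "has_pd (\<lambda>q. dphi q (Y q)) (\<Sum>j\<in>UNIV. Y p $ j *\<^sub>R pd (pd phi j) i p + pd Y i p $ j *\<^sub>R pd phi j p) i p"
    unfolding dphi_def using Ck_pd_phi[of "Suc 0"] p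
    by (intro has_pd_sum has_pd_scaleR has_pd_vec_nth Y) (auto simp: Ck_Suc)
  have "(\<Sum>j\<in>UNIV. Y p $ j *\<^sub>R pd (pd phi j) i p)
      = dphi p (\<chi> k. \<Sum>j\<in>UNIV. Gam p k i j * Y p $ j) + h p (axis i 1) (Y p) *\<^sub>R xi p"
  proof -
    have "h p (axis i 1) (Y p) = (\<Sum>j\<in>UNIV. Y p $ j * g p $ i $ j)"
      by (simp add: hform_def inner_axis' matrix_vector_mult_def mult_ac)
    moreover have "dphi p (\<chi> k. \<Sum>j\<in>UNIV. Gam p k i j * Y p $ j)
        = (\<Sum>j\<in>UNIV. \<Sum>k\<in>UNIV. (Y p $ j * Gam p k i j) *\<^sub>R pd phi k p)"
      by (subst sum.swap) (simp add: dphi_def scaleR_sum_left mult.commute)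
    ultimately show ?thesis
      by (simp add: gauss_formula[OF p] scaleR_add_right sum.distrib scaleR_sum_right scaleR_sum_left)
  qed
  then show ?thesis
    using 1 by (simp add: nab linear_add[OF linear_dphi] sum.distrib dphi_def[of p "pd Y i p"] algebra_simps)
qed

end

section \<open>The structure equations of the symmetric frame\<close>

text \<open>The value on X of the 1-form with components F i. As a named constant with its own
  rewrite rules it lets identities between 2-forms, indexed by i and j, be evaluated on frame
  vectors by simplification.\<close>

definition contract :: "real^3 \<Rightarrow> (3 \<Rightarrow> real) \<Rightarrow> real" where
  "contract X F = (\<Sum>i\<in>UNIV. X $ i * F i)"

lemma contract_simps:
  "contract X (\<lambda>i. F i + G i) = contract X F + contract X G"
  "contract X (\<lambda>i. F i - G i) = contract X F - contract X G"
  "contract X (\<lambda>i. - F i) = - contract X F"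
  "contract X (\<lambda>i. c * F i) = c * contract X F"
  "contract X (\<lambda>i. F i * c) = contract X F * c"
  "contract (r *\<^sub>R X) F = r * contract X F"
  by (simp_all add: contract_def sum_3 algebra_simps)

locale S3_hypersphere = improper_hypersphere +
  fixes T V W :: "real^3 \<Rightarrow> real^3" and a :: "real^3 \<Rightarrow> real"
  assumes S3: "S3_frame U phi xi T V W a"
    and alpha: "\<forall>p\<in>U. alpha22 phi xi T V W p = 0 \<and> alpha23 phi xi T V W p = 0"
begin

lemma Ck_T: "Ck n U T" and Ck_V: "Ck n U V" and Ck_W: "Ck n U W" and Ck_a: "Ck n U a"
  using S3 unfolding S3_frame_def smooth_on_def by blast+

lemma orthonormal:
  assumes "p \<in> U"
  shows "h p (T p) (T p) = -1" "h p (V p) (V p) = 1" "h p (W p) (W p) = 1"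
    "h p (T p) (V p) = 0" "h p (T p) (W p) = 0" "h p (V p) (W p) = 0"
    "h p (V p) (T p) = 0" "h p (W p) (T p) = 0" "h p (W p) (V p) = 0"
proof -
  show *: "h p (T p) (T p) = -1" "h p (V p) (V p) = 1" "h p (W p) (W p) = 1"
    "h p (T p) (V p) = 0" "h p (T p) (W p) = 0" "h p (V p) (W p) = 0"
    using S3 assms unfolding S3_frame_def Let_def by blast+
  show "h p (V p) (T p) = 0" "h p (W p) (T p) = 0" "h p (W p) (V p) = 0"
    using * h_sym[OF assms] by metis+
qed

lemma a_pos: "p \<in> U \<Longrightarrow> a p > 0"
  using S3 unfolding S3_frame_def Let_def by blast

lemma K_frame:
  assumes "p \<in> U"
  shows "K p (T p) X = 0" "K p (V p) (V p) = a p *\<^sub>R V p"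
    "K p (V p) (W p) = - (a p *\<^sub>R W p)" "K p (W p) (W p) = - (a p *\<^sub>R V p)"
    "K p X (T p) = 0" "K p (W p) (V p) = - (a p *\<^sub>R W p)"
proof -
  show *: "K p (T p) X = 0" "K p (V p) (V p) = a p *\<^sub>R V p"
    "K p (V p) (W p) = - (a p *\<^sub>R W p)" "K p (W p) (W p) = - (a p *\<^sub>R V p)" for X
    using S3 assms unfolding S3_frame_def Let_def by blast+
  show "K p X (T p) = 0" "K p (W p) (V p) = - (a p *\<^sub>R W p)"
    using * K_sym[OF assms] by metis+
qed

lemmas h_linear =
  bounded_bilinear.add_left[OF bilinear_h] bounded_bilinear.add_right[OF bilinear_h]
  bounded_bilinear.diff_left[OF bilinear_h] bounded_bilinear.diff_right[OF bilinear_h]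
  bounded_bilinear.minus_left[OF bilinear_h] bounded_bilinear.minus_right[OF bilinear_h]
  bounded_bilinear.scaleR_left[OF bilinear_h] bounded_bilinear.scaleR_right[OF bilinear_h]
  bounded_bilinear.zero_left[OF bilinear_h] bounded_bilinear.zero_right[OF bilinear_h]

lemma frame_coefficients:
  assumes "p \<in> U" "X = x *\<^sub>R T p + y *\<^sub>R V p + z *\<^sub>R W p"
  shows "x = - h p X (T p)" "y = h p X (V p)" "z = h p X (W p)"
  using orthonormal[OF assms(1)] by (simp_all add: assms(2) h_linear)

text \<open>Orthonormality makes the coefficient map from R^3 injective, hence surjective by
  dimension. The minus sign along T reflects h(T,T) = -1.\<close>

lemma frame_expansion:
  assumes p: "p \<in> U"
  shows "X = (- h p X (T p)) *\<^sub>R T p + h p X (V p) *\<^sub>R V p + h p X (W p) *\<^sub>R W p"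
proof -
  define L where "L = (\<lambda>v::real^3. v $ 1 *\<^sub>R T p + v $ 2 *\<^sub>R V p + v $ 3 *\<^sub>R W p)"
  have lin: "linear L"
    by (rule linearI) (simp_all add: L_def algebra_simps)
  have "v = 0" if "L v = 0" for v
  proof -
    have "0 = v $ 1 *\<^sub>R T p + v $ 2 *\<^sub>R V p + v $ 3 *\<^sub>R W p"
      using that by (simp add: L_def)
    from frame_coefficients[OF p this] show ?thesis
      by (simp add: h_linear vec_eq_iff forall_3)
  qed
  then have "inj L"
    using linear_injective_0[OF lin] by blast
  then obtain v where "X = L v"
    using linear_injective_imp_surjective[OF lin] by (metis surjD)
  then have v: "X = v $ 1 *\<^sub>R T p + v $ 2 *\<^sub>R V p + v $ 3 *\<^sub>R W p"
    by (simp add: L_def)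
  show ?thesis
    unfolding frame_coefficients[OF p v, symmetric] by (rule v)
qed

text \<open>These are metric duals, so \<open>lT\<close> takes the value -1 on T. The forms
  \<open>th1\<close>, \<open>th2\<close>, \<open>th3\<close> are the independent entries of the
  Levi-Civita connection matrix.\<close>

definition "lT i q = h q (axis i 1) (T q)"
definition "lV i q = h q (axis i 1) (V q)"
definition "lW i q = h q (axis i 1) (W q)"
definition "th1 i q = h q (lc_deriv T i q) (V q)"
definition "th2 i q = h q (lc_deriv T i q) (W q)"
definition "th3 i q = h q (lc_deriv V i q) (W q)"

lemma contract_hform: "contract X (\<lambda>i. h p (axis i 1) Y) = h p X Y"
proof -
  have "h p (\<Sum>i\<in>UNIV. X $ i *\<^sub>R axis i 1) Y = contract X (\<lambda>i. h p (axis i 1) Y)"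
    by (simp add: bounded_bilinear.sum_left[OF bilinear_h] h_linear contract_def)
  then show ?thesis
    by (simp add: basis_expansion_scaleR)
qed

lemma contract_coframe: "contract X (\<lambda>i. lT i p) = h p X (T p)" "contract X (\<lambda>i. lV i p) = h p X (V p)"
    "contract X (\<lambda>i. lW i p) = h p X (W p)"
  by (simp_all add: lT_def lV_def lW_def contract_hform)

lemma Ck_h: "Ck n U Y \<Longrightarrow> Ck n U Z \<Longrightarrow> Ck n U (\<lambda>q. h q (Y q) (Z q))"
  unfolding h_expand by (intro Ck_sum Ck_mult Ck_vec_nth open_U Ck_g)

lemma Ck_lc_deriv: "Ck (Suc n) U Y \<Longrightarrow> Ck n U (lc_deriv Y i)"
proof -
  assume Y: "Ck (Suc n) U Y"
  have "Ck n U (\<lambda>q. \<chi> k. \<Sum>j\<in>UNIV. lc q k i j * Y q $ j)"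
    by (rule Ck_vec[OF open_U])
      (simp, intro Ck_sum Ck_mult Ck_vec_nth open_U Ck_lc Ck_Suc_imp[OF Y])
  then have "Ck n U (\<lambda>q. pd Y i q + (\<chi> k. \<Sum>j\<in>UNIV. lc q k i j * Y q $ j))"
    using Y by (intro Ck_add open_U) (simp_all add: Ck_Suc)
  then show ?thesis
    by (simp add: lc_deriv_def[abs_def])
qed

lemma Ck_forms: "Ck n U (lT i)" "Ck n U (lV i)" "Ck n U (lW i)"
    "Ck n U (th1 i)" "Ck n U (th2 i)" "Ck n U (th3 i)"
  unfolding lT_def[abs_def] lV_def[abs_def] lW_def[abs_def] th1_def[abs_def] th2_def[abs_def] th3_def[abs_def]
  by (intro Ck_h Ck_const open_U Ck_T Ck_V Ck_W Ck_lc_deriv)+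

lemma has_pd_of_Ck: "p \<in> U \<Longrightarrow> Ck (Suc 0) U f \<Longrightarrow> has_pd f (pd f i p) i p"
  by (simp add: Ck_Suc)

text \<open>Metric compatibility applied to the constant function h(Y, Z).\<close>

lemma lc_deriv_skew:
  assumes p: "p \<in> U" and "Ck (Suc 0) U Y" "Ck (Suc 0) U Z" and c: "\<And>q. q \<in> U \<Longrightarrow> h q (Y q) (Z q) = c"
  shows "h p (lc_deriv Z i p) (Y p) = - h p (lc_deriv Y i p) (Z p)"
proof -
  have "has_pd (\<lambda>q. h q (Y q) (Z q)) (h p (lc_deriv Y i p) (Z p) + h p (Y p) (lc_deriv Z i p)) i p"
    using assms by (intro metric_compatible has_pd_of_Ck)
  moreover have "has_pd (\<lambda>q. h q (Y q) (Z q)) 0 i p"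
    by (rule has_pd_cong_open[OF open_U p _ has_pd_const[of c]]) (simp add: c)
  ultimately have "h p (lc_deriv Y i p) (Z p) + h p (Y p) (lc_deriv Z i p) = 0"
    using has_pd_imp_pd by metis
  then show ?thesis
    using h_sym[OF p, of "Y p" "lc_deriv Z i p"] by simp
qed

text \<open>Skewness for h fixes the six remaining entries. Because T is timelike,
  \<open>th1\<close> and \<open>th2\<close> appear with the same sign in both places, unlike
  \<open>th3\<close>.\<close>

lemma lc_deriv_frame:
  assumes p: "p \<in> U"
  shows "lc_deriv T i p = th1 i p *\<^sub>R V p + th2 i p *\<^sub>R W p"
    "lc_deriv V i p = th1 i p *\<^sub>R T p + th3 i p *\<^sub>R W p"
    "lc_deriv W i p = th2 i p *\<^sub>R T p - th3 i p *\<^sub>R V p"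
proof -
  note skew = lc_deriv_skew[OF p, of _ _ _ i]
  have TT: "h p (lc_deriv T i p) (T p) = 0"
    using skew[OF Ck_T Ck_T, of "-1"] orthonormal by simp
  have VV: "h p (lc_deriv V i p) (V p) = 0"
    using skew[OF Ck_V Ck_V, of 1] orthonormal by simp
  have WW: "h p (lc_deriv W i p) (W p) = 0"
    using skew[OF Ck_W Ck_W, of 1] orthonormal by simp
  have VT: "h p (lc_deriv V i p) (T p) = - th1 i p"
    using skew[OF Ck_T Ck_V, of 0] orthonormal by (simp add: th1_def)
  have WT: "h p (lc_deriv W i p) (T p) = - th2 i p"
    using skew[OF Ck_T Ck_W, of 0] orthonormal by (simp add: th2_def)
  have WV: "h p (lc_deriv W i p) (V p) = - th3 i p"
    using skew[OF Ck_V Ck_W, of 0] orthonormal by (simp add: th3_def)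
  show "lc_deriv T i p = th1 i p *\<^sub>R V p + th2 i p *\<^sub>R W p"
    by (subst frame_expansion[OF p, of "lc_deriv T i p"]) (simp add: TT th1_def th2_def)
  show "lc_deriv V i p = th1 i p *\<^sub>R T p + th3 i p *\<^sub>R W p"
    by (subst frame_expansion[OF p, of "lc_deriv V i p"]) (simp add: VT VV th3_def)
  show "lc_deriv W i p = th2 i p *\<^sub>R T p - th3 i p *\<^sub>R V p"
    by (subst frame_expansion[OF p, of "lc_deriv W i p"]) (simp add: WT WV WW)
qed

text \<open>Reading V, W as 1, i, the tensor K(X, Z) is a times the complex conjugate of the product
  X Z; this is its traceless symmetric matrix.\<close>

lemma K_axis:
  assumes p: "p \<in> U"
  shows "K p (axis i 1) (T p) = 0"
    "K p (axis i 1) (V p) = (a p * lV i p) *\<^sub>R V p - (a p * lW i p) *\<^sub>R W p"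
    "K p (axis i 1) (W p) = - (a p * lW i p) *\<^sub>R V p - (a p * lV i p) *\<^sub>R W p"
proof -
  have ax: "axis i 1 = (- lT i p) *\<^sub>R T p + lV i p *\<^sub>R V p + lW i p *\<^sub>R W p"
    using frame_expansion[OF p, of "axis i 1"] by (simp add: lT_def lV_def lW_def)
  have lin: "K p X (axis i 1) = (- lT i p) *\<^sub>R K p X (T p) + lV i p *\<^sub>R K p X (V p) + lW i p *\<^sub>R K p X (W p)" for X
    by (subst ax) (simp only: linear_add[OF K_linear] linear_scale[OF K_linear])
  show "K p (axis i 1) (T p) = 0"
    by (rule K_frame[OF p])
  show "K p (axis i 1) (V p) = (a p * lV i p) *\<^sub>R V p - (a p * lW i p) *\<^sub>R W p"
    by (subst K_sym[OF p], subst lin) (simp add: K_frame[OF p] mult.commute)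
  show "K p (axis i 1) (W p) = - (a p * lW i p) *\<^sub>R V p - (a p * lV i p) *\<^sub>R W p"
    by (subst K_sym[OF p], subst lin) (simp add: K_frame[OF p] mult.commute)
qed

definition "frame_field b q = (if b = (1::4) then dphi q (T q) else if b = 2 then dphi q (V q)
    else if b = 3 then dphi q (W q) else xi q)"

lemma frame_field_eqs: "frame_field 1 = (\<lambda>q. dphi q (T q))" "frame_field 2 = (\<lambda>q. dphi q (V q))"
    "frame_field 3 = (\<lambda>q. dphi q (W q))" "frame_field 4 = xi"
  by (simp_all add: frame_field_def fun_eq_iff)

text \<open>Row r holds the components of the derivative of the r-th frame field along the i-th axis.\<close>

definition "conn_form i q = (\<chi> r c.
    if r = (1::4) then
      (if c = (1::4) then 0 else if c = 2 then th1 i q else if c = 3 then th2 i q else lT i q)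
    else if r = 2 then
      (if c = 1 then th1 i q else if c = 2 then a q * lV i q else if c = 3 then th3 i q - a q * lW i q else lV i q)
    else if r = 3 then
      (if c = 1 then th2 i q else if c = 2 then - th3 i q - a q * lW i q else if c = 3 then - (a q * lV i q) else lW i q)
    else 0)"

lemma has_pd_frame_field:
  assumes p: "p \<in> U"
  shows "has_pd (frame_field b) (\<Sum>c\<in>UNIV. conn_form i p $ b $ c *\<^sub>R frame_field c p) i p"
proof -
  note dphi_lin = linear_add[OF linear_dphi] linear_diff[OF linear_dphi] linear_scale[OF linear_dphi]
  have 1: "has_pd (\<lambda>q. dphi q (T q)) (\<Sum>c\<in>UNIV. conn_form i p $ 1 $ c *\<^sub>R frame_field c p) i p"
    using has_pd_dphi[OF p has_pd_of_Ck[OF p Ck_T], of i]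
    by (simp add: lc_deriv_frame[OF p] K_axis[OF p] dphi_lin sum_4 conn_form_def frame_field_def lT_def)
  have 2: "has_pd (\<lambda>q. dphi q (V q)) (\<Sum>c\<in>UNIV. conn_form i p $ 2 $ c *\<^sub>R frame_field c p) i p"
    using has_pd_dphi[OF p has_pd_of_Ck[OF p Ck_V], of i]
    by (simp add: lc_deriv_frame[OF p] K_axis[OF p] dphi_lin sum_4 conn_form_def frame_field_def lV_def algebra_simps)
  have 3: "has_pd (\<lambda>q. dphi q (W q)) (\<Sum>c\<in>UNIV. conn_form i p $ 3 $ c *\<^sub>R frame_field c p) i p"
    using has_pd_dphi[OF p has_pd_of_Ck[OF p Ck_W], of i]
    by (simp add: lc_deriv_frame[OF p] K_axis[OF p] dphi_lin sum_4 conn_form_def frame_field_def lW_def algebra_simps)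
  have 4: "has_pd xi (\<Sum>c\<in>UNIV. conn_form i p $ 4 $ c *\<^sub>R frame_field c p) i p"
    using has_pd_xi[OF p] by (simp add: conn_form_def)
  consider "b = 1" | "b = 2" | "b = 3" | "b = 4"
    using exhaust_4 by blast
  then show ?thesis
    by cases (simp_all only: frame_field_eqs 1 2 3 4)
qed

lemma frame_field_independent:
  assumes p: "p \<in> U" and 0: "(\<Sum>b\<in>UNIV. c b *\<^sub>R frame_field b p) = 0"
  shows "\<forall>b. c b = 0"
proof -
  define u where "u = c 1 *\<^sub>R T p + c 2 *\<^sub>R V p + c 3 *\<^sub>R W p"
  have "dphi p u + c 4 *\<^sub>R xi p = 0"
    using 0 by (simp add: u_def sum_4 frame_field_def linear_add[OF linear_dphi] linear_scale[OF linear_dphi])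
  then have "u = 0" "c 4 = 0"
    using frame_independent[OF p] by (simp_all add: dphi_def)
  moreover from this have "c 1 = 0" "c 2 = 0" "c 3 = 0"
    using frame_coefficients[OF p u_def] by (simp_all add: h_linear)
  ultimately show ?thesis
    by (simp add: forall_4)
qed

lemma structure_equation:
  assumes p: "p \<in> U"
  shows "pd (\<lambda>q. conn_form i q $ r $ c) j p + (conn_form i p ** conn_form j p) $ r $ c
       = pd (\<lambda>q. conn_form j q $ r $ c) i p + (conn_form j p ** conn_form i p) $ r $ c"
proof (rule frame_structure_equation[OF open_U p has_pd_frame_field])
  note forms = Ck_forms[of "Suc 0"]
  show "Ck (Suc 0) U (\<lambda>q. conn_form i q $ r $ c)" for r c i
    unfolding conn_form_def using exhaust_4[of r] exhaust_4[of c] forms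
    by (auto intro!: Ck_const Ck_diff Ck_minus Ck_mult open_U Ck_a)
  have "Ck 0 U (\<lambda>q. dphi q (Y q))" if "Ck 0 U Y" for Y
    unfolding dphi_def using that by (intro Ck_sum Ck_scaleR Ck_vec_nth open_U Ck_pd_phi)
  then show "Ck 0 U (frame_field b)" for b
    using exhaust_4[of b] Ck_T[of 0] Ck_V[of 0] Ck_W[of 0] Ck_xi[of 0] frame_field_eqs by metis
  show "\<forall>b. c b = 0" if "(\<Sum>b\<in>UNIV. c b *\<^sub>R frame_field b p) = 0" for c
    using frame_field_independent[OF p that] .
qed

section \<open>Entries of the flatness equation\<close>

lemma pd_conn_form:
  assumes p: "p \<in> U"
  shows "pd (\<lambda>q. th3 i q - a q * lW i q) j p = pd (th3 i) j p - (a p * pd (lW i) j p + pd a j p * lW i p)"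
    "pd (\<lambda>q. - th3 i q - a q * lW i q) j p = - pd (th3 i) j p - (a p * pd (lW i) j p + pd a j p * lW i p)"
    "pd (\<lambda>q. a q * lV i q) j p = a p * pd (lV i) j p + pd a j p * lV i p"
  by (intro has_pd_imp_pd has_pd_diff has_pd_minus has_pd_mult has_pd_of_Ck p Ck_forms Ck_a)+

lemmas conn_form_simps = conn_form_def matrix_matrix_mult_def sum_4

text \<open>Entries (1,2) and (2,1) contain the same derivative of \<open>th1\<close> and,
  antisymmetrised in i and j, the same \<open>th3\<close> terms. Their difference is 2a times a
  purely algebraic relation; likewise for (1,3) and (3,1). Together they are the real and imaginary
  parts of (lV + i lW) wedge (th1 + i th2) = 0.\<close>

lemma
  assumes p: "p \<in> U"
  shows th_relation1: "lV i p * th1 j p - lV j p * th1 i p = lW i p * th2 j p - lW j p * th2 i p"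
    and th_relation2: "lW i p * th1 j p - lW j p * th1 i p + lV i p * th2 j p - lV j p * th2 i p = 0"
proof -
  have 12: "pd (th1 i) j p + (th1 i p * (a p * lV j p) + th2 i p * (- th3 j p - a p * lW j p))
      = pd (th1 j) i p + (th1 j p * (a p * lV i p) + th2 j p * (- th3 i p - a p * lW i p))"
    using structure_equation[OF p, of i 1 2 j] by (simp add: conn_form_simps)
  have 21: "pd (th1 i) j p + (a p * lV i p * th1 j p + (th3 i p - a p * lW i p) * th2 j p)
      = pd (th1 j) i p + (a p * lV j p * th1 i p + (th3 j p - a p * lW j p) * th2 i p)"
    using structure_equation[OF p, of i 2 1 j] by (simp add: conn_form_simps)
  have 13: "pd (th2 i) j p + (th1 i p * (th3 j p - a p * lW j p) - th2 i p * (a p * lV j p))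
      = pd (th2 j) i p + (th1 j p * (th3 i p - a p * lW i p) - th2 j p * (a p * lV i p))"
    using structure_equation[OF p, of i 1 3 j] by (simp add: conn_form_simps)
  have 31: "pd (th2 i) j p + ((- th3 i p - a p * lW i p) * th1 j p - a p * lV i p * th2 j p)
      = pd (th2 j) i p + ((- th3 j p - a p * lW j p) * th1 i p - a p * lV j p * th2 i p)"
    using structure_equation[OF p, of i 3 1 j] by (simp add: conn_form_simps)
  have "2 * a p * (lV i p * th1 j p - lV j p * th1 i p - (lW i p * th2 j p - lW j p * th2 i p)) = 0"
    using 12 21 by algebra
  then show "lV i p * th1 j p - lV j p * th1 i p = lW i p * th2 j p - lW j p * th2 i p"
    using a_pos[OF p] by simp
  have "2 * a p * (lW i p * th1 j p - lW j p * th1 i p + lV i p * th2 j p - lV j p * th2 i p) = 0"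
    using 13 31 by algebra
  then show "lW i p * th1 j p - lW j p * th1 i p + lV i p * th2 j p - lV j p * th2 i p = 0"
    using a_pos[OF p] by simp
qed

text \<open>The wedge relation makes th1 + i th2 a complex multiple of lV + i lW. Evaluation on V,
  where lV + i lW is 1, shows the multiple to be alpha22 + i alpha23 = 0.\<close>

lemma th_zero:
  assumes p: "p \<in> U"
  shows "th1 j p = 0" "th2 j p = 0"
proof -
  have "alpha22 phi xi T V W p = contract (V p) (\<lambda>i. th1 i p)" "alpha23 phi xi T V W p = contract (V p) (\<lambda>i. th2 i p)"
    by (simp_all add: alpha22_def alpha23_def lc_cov_eq bounded_bilinear.sum_left[OF bilinear_h]
        h_linear contract_def th1_def th2_def)
  then have 0: "contract (V p) (\<lambda>i. th1 i p) = 0" "contract (V p) (\<lambda>i. th2 i p) = 0"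
    using alpha p by simp_all
  have "contract (V p) (\<lambda>i. lV i p * th1 j p - lV j p * th1 i p) = contract (V p) (\<lambda>i. lW i p * th2 j p - lW j p * th2 i p)"
    using th_relation1[OF p] by simp
  then show "th1 j p = 0"
    by (simp add: contract_simps contract_coframe orthonormal[OF p] 0)
  have "contract (V p) (\<lambda>i. lW i p * th1 j p - lW j p * th1 i p + lV i p * th2 j p - lV j p * th2 i p) = contract (V p) (\<lambda>i. 0)"
    using th_relation2[OF p] by simp
  then show "th2 j p = 0"
    by (simp add: contract_simps contract_coframe orthonormal[OF p] 0) (simp add: contract_def)
qed

lemma pd_th_zero: "p \<in> U \<Longrightarrow> pd (th1 i) j p = 0" "p \<in> U \<Longrightarrow> pd (th2 i) j p = 0"
  using has_pd_imp_pd[OF has_pd_cong_open[OF open_U _ _ has_pd_const[of 0]]] th_zero by metis+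

text \<open>The last column yields the torsion equations, (2,2) one Codazzi equation, and (2,3) with
  (3,2) the other one and Gauss. The factor 3 collects two \<open>th3\<close> terms from the matrix
  product and one from the derivative of \<open>lV\<close> or \<open>lW\<close>.\<close>

lemma
  assumes p: "p \<in> U"
  shows d_lT: "pd (lT i) j p = pd (lT j) i p"
    and d_lV: "pd (lV i) j p - pd (lV j) i p = - (th3 i p * lW j p - th3 j p * lW i p)"
    and d_lW: "pd (lW i) j p - pd (lW j) i p = th3 i p * lV j p - th3 j p * lV i p"
    and da_lV: "pd a j p * lV i p - pd a i p * lV j p = 3 * a p * (th3 i p * lW j p - th3 j p * lW i p)"
    and da_lW: "pd a j p * lW i p - pd a i p * lW j p = - 3 * a p * (th3 i p * lV j p - th3 j p * lV i p)"
    and d_th3: "pd (th3 j) i p - pd (th3 i) j p = 2 * (a p)\<^sup>2 * (lW i p * lV j p - lW j p * lV i p)"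
proof -
  note simps = conn_form_simps th_zero[OF p] pd_th_zero[OF p] pd_conn_form[OF p]
  have 14: "pd (lT i) j p = pd (lT j) i p"
    using structure_equation[OF p, of i 1 4 j] by (simp add: simps)
  then show "pd (lT i) j p = pd (lT j) i p" .
  have 24: "pd (lV i) j p + (a p * lV i p * lV j p + (th3 i p - a p * lW i p) * lW j p)
      = pd (lV j) i p + (a p * lV j p * lV i p + (th3 j p - a p * lW j p) * lW i p)"
    using structure_equation[OF p, of i 2 4 j] by (simp add: simps)
  then show d24: "pd (lV i) j p - pd (lV j) i p = - (th3 i p * lW j p - th3 j p * lW i p)"
    by algebra
  have 34: "pd (lW i) j p + ((- th3 i p - a p * lW i p) * lV j p - a p * lV i p * lW j p)
      = pd (lW j) i p + ((- th3 j p - a p * lW j p) * lV i p - a p * lV j p * lW i p)"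
    using structure_equation[OF p, of i 3 4 j] by (simp add: simps)
  then show d34: "pd (lW i) j p - pd (lW j) i p = th3 i p * lV j p - th3 j p * lV i p"
    by algebra
  have 22: "a p * pd (lV i) j p + pd a j p * lV i p
        + (a p * lV i p * (a p * lV j p) + (th3 i p - a p * lW i p) * (- th3 j p - a p * lW j p))
      = a p * pd (lV j) i p + pd a i p * lV j p
        + (a p * lV j p * (a p * lV i p) + (th3 j p - a p * lW j p) * (- th3 i p - a p * lW i p))"
    using structure_equation[OF p, of i 2 2 j] by (simp add: simps)
  then show "pd a j p * lV i p - pd a i p * lV j p = 3 * a p * (th3 i p * lW j p - th3 j p * lW i p)"
    using d24 by algebra
  have 23: "pd (th3 i) j p - (a p * pd (lW i) j p + pd a j p * lW i p)
        + (a p * lV i p * (th3 j p - a p * lW j p) - (th3 i p - a p * lW i p) * (a p * lV j p))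
      = pd (th3 j) i p - (a p * pd (lW j) i p + pd a i p * lW j p)
        + (a p * lV j p * (th3 i p - a p * lW i p) - (th3 j p - a p * lW j p) * (a p * lV i p))"
    using structure_equation[OF p, of i 2 3 j] by (simp add: simps)
  have 32: "- pd (th3 i) j p - (a p * pd (lW i) j p + pd a j p * lW i p)
        + ((- th3 i p - a p * lW i p) * (a p * lV j p) - a p * lV i p * (- th3 j p - a p * lW j p))
      = - pd (th3 j) i p - (a p * pd (lW j) i p + pd a i p * lW j p)
        + ((- th3 j p - a p * lW j p) * (a p * lV i p) - a p * lV j p * (- th3 i p - a p * lW i p))"
    using structure_equation[OF p, of i 3 2 j] by (simp add: simps)
  \<comment> \<open>Adding (2,3) and (3,2) cancels the derivatives of \<open>th3\<close> and leaves
    Codazzi; subtracting them cancels the derivatives of \<open>a\<close> and \<open>lW\<close> and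
    leaves Gauss.\<close>
  show "pd a j p * lW i p - pd a i p * lW j p = - 3 * a p * (th3 i p * lV j p - th3 j p * lV i p)"
    using 23 32 d34 by algebra
  show "pd (th3 j) i p - pd (th3 i) j p = 2 * (a p)\<^sup>2 * (lW i p * lV j p - lW j p * lV i p)"
    using 23 32 by algebra
qed

end

section \<open>Isothermal coordinates\<close>

context S3_hypersphere
begin

text \<open>etaV + i etaW is the cube root of the cubic differential a (lV + i lW)^3 behind K, and
  X, Y are dual to it. \<open>A\<close> and \<open>B\<close> are X(k) and Y(k), which become k_v and
  k_w in the coordinates.\<close>

definition "k q = ln (a q)"
definition "etaV i q = exp (k q / 3) * lV i q"
definition "etaW i q = exp (k q / 3) * lW i q"
definition "X q = exp (- (k q / 3)) *\<^sub>R V q"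
definition "Y q = exp (- (k q / 3)) *\<^sub>R W q"
definition "A q = contract (X q) (\<lambda>i. pd k i q)"
definition "B q = contract (Y q) (\<lambda>i. pd k i q)"

lemma exp_k: "p \<in> U \<Longrightarrow> exp (k p) = a p"
  by (simp add: k_def a_pos)

lemma Ck_k: "Ck n U k"
  unfolding k_def[abs_def] by (intro Ck_ln open_U Ck_a a_pos)

lemma Ck_exp_k: "Ck n U (\<lambda>q. exp (c * k q))"
  by (intro Ck_exp Ck_mult Ck_const open_U Ck_k)

lemma Ck_eta: "Ck n U (etaV i)" "Ck n U (etaW i)"
  using Ck_exp_k[of n "1/3"] unfolding etaV_def[abs_def] etaW_def[abs_def]
  by (auto intro!: Ck_mult Ck_forms open_U)

lemma Ck_XY: "Ck n U X" "Ck n U Y"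
  using Ck_exp_k[of n "-1/3"] unfolding X_def[abs_def] Y_def[abs_def]
  by (auto intro!: Ck_scaleR Ck_V Ck_W open_U)

lemma Ck_pd_k: "Ck n U (pd k i)"
  using Ck_k[of "Suc n"] by (simp add: Ck_Suc)

lemma Ck_AB: "Ck n U A" "Ck n U B"
  unfolding A_def[abs_def] B_def[abs_def] contract_def
  by (intro Ck_sum Ck_mult Ck_vec_nth Ck_XY Ck_pd_k open_U)+

lemma pd_k: "p \<in> U \<Longrightarrow> pd k i p = pd a i p / a p"
  unfolding k_def[abs_def]
  using has_pd_imp_pd[OF has_pd_real_compose[OF has_pd_of_Ck[OF _ Ck_a] DERIV_ln[OF a_pos]]]
  by (simp add: field_simps)

lemma pd_exp_k_mult:
  assumes p: "p \<in> U" and f: "Ck (Suc 0) U f"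
  shows "pd (\<lambda>q. exp (k q / 3) * f q) j p = exp (k p / 3) * (pd f j p + pd k j p / 3 * f p)"
proof -
  have "has_pd (\<lambda>q. exp (k q / 3)) (exp (k p / 3) / 3 * pd k j p) j p"
    by (rule has_pd_real_compose[OF has_pd_of_Ck[OF p Ck_k], where g="\<lambda>x. exp (x / 3)"])
      (auto intro!: derivative_eq_intros)
  from has_pd_imp_pd[OF has_pd_mult[OF this has_pd_of_Ck[OF p f]]] show ?thesis
    by (simp add: algebra_simps)
qed

text \<open>Codazzi contains 3a times the \<open>th3\<close> terms of the torsion equation with the
  opposite sign, so one third of dk is exactly what cancels them.\<close>

lemma d_eta:
  assumes p: "p \<in> U"
  shows "pd (etaV i) j p = pd (etaV j) i p" "pd (etaW i) j p = pd (etaW j) i p"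
proof -
  have "pd (lV i) j p + pd k j p / 3 * lV i p = pd (lV j) i p + pd k i p / 3 * lV j p"
  proof -
    have "3 * a p * (pd (lV i) j p - pd (lV j) i p) + (pd a j p * lV i p - pd a i p * lV j p) = 0"
      unfolding d_lV[OF p] da_lV[OF p] by algebra
    then show ?thesis
      using a_pos[OF p] by (simp add: pd_k[OF p] field_simps)
  qed
  then show "pd (etaV i) j p = pd (etaV j) i p"
    unfolding etaV_def[abs_def] by (simp only: pd_exp_k_mult[OF p Ck_forms(2)])
  have "pd (lW i) j p + pd k j p / 3 * lW i p = pd (lW j) i p + pd k i p / 3 * lW j p"
  proof -
    have "3 * a p * (pd (lW i) j p - pd (lW j) i p) + (pd a j p * lW i p - pd a i p * lW j p) = 0"
      unfolding d_lW[OF p] da_lW[OF p] by algebra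
    then show ?thesis
      using a_pos[OF p] by (simp add: pd_k[OF p] field_simps)
  qed
  then show "pd (etaW i) j p = pd (etaW j) i p"
    unfolding etaW_def[abs_def] by (simp only: pd_exp_k_mult[OF p Ck_forms(3)])
qed

text \<open>Codazzi contracted with V reads da = V(a) lV + 3a th3(V) lW. It has no \<open>lT\<close>
  part, so T(a) = 0, and on W it gives W(a) = 3a th3(V). The second Codazzi equation contracted with
  V then solves for \<open>th3\<close>; in the rescaled frame and coframe the factors exp(k/3) and
  exp(-k/3) cancel.\<close>

lemma
  assumes p: "p \<in> U"
  shows dk_T: "contract (T p) (\<lambda>i. pd k i p) = 0"
    and th3_eq: "th3 j p = (1/3) * (B p * etaV j p - A p * etaW j p)"
proof -
  note eval = contract_simps contract_coframe orthonormal[OF p]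
  have V1: "pd a j p - contract (V p) (\<lambda>i. pd a i p) * lV j p = 3 * a p * (contract (V p) (\<lambda>i. th3 i p) * lW j p)" for j
  proof -
    have "contract (V p) (\<lambda>i. pd a j p * lV i p - pd a i p * lV j p)
        = contract (V p) (\<lambda>i. 3 * a p * (th3 i p * lW j p - th3 j p * lW i p))"
      using da_lV[OF p] by simp
    then show ?thesis
      by (simp add: eval)
  qed
  have "contract (T p) (\<lambda>j. pd a j p - contract (V p) (\<lambda>i. pd a i p) * lV j p)
      = contract (T p) (\<lambda>j. 3 * a p * (contract (V p) (\<lambda>i. th3 i p) * lW j p))"
    using V1 by simp
  then have "contract (T p) (\<lambda>i. pd a i p) = 0"
    by (simp add: eval)
  then have "contract (T p) (\<lambda>i. inverse (a p) * pd a i p) = 0"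
    by (simp add: contract_simps)
  then show "contract (T p) (\<lambda>i. pd k i p) = 0"
    by (simp add: pd_k[OF p] field_simps)
  have "contract (W p) (\<lambda>j. pd a j p - contract (V p) (\<lambda>i. pd a i p) * lV j p)
      = contract (W p) (\<lambda>j. 3 * a p * (contract (V p) (\<lambda>i. th3 i p) * lW j p))"
    using V1 by simp
  then have th3V: "contract (W p) (\<lambda>i. pd a i p) = 3 * a p * contract (V p) (\<lambda>i. th3 i p)"
    by (simp add: eval)
  have "contract (V p) (\<lambda>i. pd a j p * lW i p - pd a i p * lW j p)
      = contract (V p) (\<lambda>i. - 3 * a p * (th3 i p * lV j p - th3 j p * lV i p))"
    using da_lW[OF p] by simp
  then have "contract (V p) (\<lambda>i. pd a i p) * lW j p = 3 * a p * (contract (V p) (\<lambda>i. th3 i p) * lV j p - th3 j p)"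
    by (simp add: eval)
  then have 3: "3 * a p * th3 j p = contract (W p) (\<lambda>i. pd a i p) * lV j p - contract (V p) (\<lambda>i. pd a i p) * lW j p"
    unfolding th3V by algebra
  have da: "contract Z (\<lambda>i. pd a i p) = a p * contract Z (\<lambda>i. pd k i p)" for Z
    using a_pos[OF p] by (simp add: pd_k[OF p] flip: contract_simps(4))
  have "3 * th3 j p = contract (W p) (\<lambda>i. pd k i p) * lV j p - contract (V p) (\<lambda>i. pd k i p) * lW j p"
    using 3 a_pos[OF p] unfolding da by (simp add: mult.assoc flip: right_diff_distrib)
  moreover have "B p * etaV j p = contract (W p) (\<lambda>i. pd k i p) * lV j p"
    "A p * etaW j p = contract (V p) (\<lambda>i. pd k i p) * lW j p"
    by (simp_all add: A_def B_def X_def Y_def etaV_def etaW_def contract_simps exp_minus field_simps)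
  ultimately show "th3 j p = (1/3) * (B p * etaV j p - A p * etaW j p)"
    by simp
qed

lemma contract_eta:
  assumes p: "p \<in> U"
  shows "contract (T p) (\<lambda>i. etaV i p) = 0" "contract (T p) (\<lambda>i. etaW i p) = 0"
    "contract (X p) (\<lambda>i. etaV i p) = 1" "contract (X p) (\<lambda>i. etaW i p) = 0"
    "contract (Y p) (\<lambda>i. etaV i p) = 0" "contract (Y p) (\<lambda>i. etaW i p) = 1"
  by (simp_all add: etaV_def etaW_def X_def Y_def contract_simps contract_coframe h_linear orthonormal[OF p] exp_minus)

text \<open>As the eta forms are closed, 3 d th3 = dB wedge etaV - dA wedge etaW, which on (X, Y) is
  -(X(A) + Y(B)). By the Gauss equation it is also -6 a^2 (lV wedge lW)(X, Y), where lV wedge lW has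
  the value a^(-2/3).\<close>

lemma laplace:
  assumes p: "p \<in> U"
  shows "contract (X p) (\<lambda>i. pd A i p) + contract (Y p) (\<lambda>i. pd B i p) = 6 * exp (4/3 * k p)"
proof -
  define e where "e = exp (- (k p / 3))"
  have contract_l: "contract (X p) (\<lambda>i. lV i p) = e" "contract (X p) (\<lambda>i. lW i p) = 0"
    "contract (Y p) (\<lambda>i. lV i p) = 0" "contract (Y p) (\<lambda>i. lW i p) = e"
    by (simp_all add: X_def Y_def contract_simps contract_coframe h_linear orthonormal[OF p] e_def)
  have pd_th3: "pd (th3 j) i p = (1/3) * ((B p * pd (etaV j) i p + pd B i p * etaV j p)
      - (A p * pd (etaW j) i p + pd A i p * etaW j p))" for i j
  proof -
    have "has_pd (\<lambda>q. (1/3) * (B q * etaV j q - A q * etaW j q))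
      ((1/3) * ((B p * pd (etaV j) i p + pd B i p * etaV j p)
      - (A p * pd (etaW j) i p + pd A i p * etaW j p)) + 0 * (B p * etaV j p - A p * etaW j p)) i p"
      by (intro has_pd_mult has_pd_diff has_pd_const has_pd_of_Ck p Ck_eta Ck_AB)
    moreover have "pd (th3 j) i p = pd (\<lambda>q. (1/3) * (B q * etaV j q - A q * etaW j q)) i p"
      by (rule pd_cong_open[OF open_U p th3_eq])
    ultimately show ?thesis
      using has_pd_imp_pd by force
  qed
  have eq: "(pd B i p * etaV j p - pd B j p * etaV i p) - (pd A i p * etaW j p - pd A j p * etaW i p)
      = 6 * (a p)\<^sup>2 * (lW i p * lV j p - lW j p * lV i p)" for i j
    using d_th3[OF p, of j i] d_eta[OF p, of i j] unfolding pd_th3 by algebra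
  have "contract (X p) (\<lambda>i. (pd B i p * etaV j p - pd B j p * etaV i p) - (pd A i p * etaW j p - pd A j p * etaW i p))
      = contract (X p) (\<lambda>i. 6 * (a p)\<^sup>2 * (lW i p * lV j p - lW j p * lV i p))" for j
    unfolding eq ..
  then have eqX: "contract (X p) (\<lambda>i. pd B i p) * etaV j p - pd B j p - contract (X p) (\<lambda>i. pd A i p) * etaW j p
      = - (6 * (a p)\<^sup>2 * (lW j p * e))" for j
    by (simp add: contract_simps contract_eta[OF p] contract_l)
  have "contract (Y p) (\<lambda>j. contract (X p) (\<lambda>i. pd B i p) * etaV j p - pd B j p - contract (X p) (\<lambda>i. pd A i p) * etaW j p)
      = contract (Y p) (\<lambda>j. - (6 * (a p)\<^sup>2 * (lW j p * e)))"
    unfolding eqX ..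
  then have "contract (X p) (\<lambda>i. pd A i p) + contract (Y p) (\<lambda>i. pd B i p) = 6 * ((a p)\<^sup>2 * (e * e))"
    by (simp add: contract_simps contract_eta[OF p] contract_l)
  \<comment> \<open>In terms of k the product is exp(2k - 2k/3), whence the exponent 4/3.\<close>
  also have "(a p)\<^sup>2 * (e * e) = exp (4/3 * k p)"
    unfolding exp_k[OF p, symmetric] e_def by (simp add: power2_eq_square flip: exp_add)
  finally show ?thesis .
qed

end

section \<open>The slice t = 0 and functions of (v, w)\<close>

definition emb :: "real^2 \<Rightarrow> real^3" where
  "emb y = vector [0, y $ 1, y $ 2]"

lemma emb_axis:
  "emb (y + s *\<^sub>R axis 1 1) = emb y + s *\<^sub>R axis 2 1"
  "emb (y + s *\<^sub>R axis 2 1) = emb y + s *\<^sub>R axis 3 1"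
  by (simp_all add: emb_def vec_eq_iff forall_3 axis_def)

text \<open>The axes of the plane go to the last two axes of space, so both sides differentiate the
  same curve and agree for every G.\<close>

lemma pd_emb: "pd (\<lambda>y. G (emb y)) 1 = (\<lambda>y. pd G 2 (emb y))" "pd (\<lambda>y. G (emb y)) 2 = (\<lambda>y. pd G 3 (emb y))"
  by (simp_all add: pd_def emb_axis fun_eq_iff)

lemma continuous_on_emb: "continuous_on S emb"
proof -
  have *: "emb = (\<lambda>y. y $ 1 *\<^sub>R axis 2 1 + y $ 2 *\<^sub>R axis 3 1)"
    by (simp add: emb_def fun_eq_iff vec_eq_iff forall_3 axis_def)
  show ?thesis
    unfolding * by (intro continuous_intros)
qed

lemma Ck_emb: "Ck n S G \<Longrightarrow> Ck n (emb -` S) (\<lambda>y. G (emb y))"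
proof (induction n arbitrary: G)
  case 0
  then show ?case
    by (auto intro: continuous_on_compose2[of S G _ emb] continuous_on_emb)
next
  case (Suc n)
  have "continuous_on (emb -` S) (\<lambda>y. G (emb y))"
    using Ck_continuous[OF Suc.prems] by (auto intro: continuous_on_compose2[of S G _ emb] continuous_on_emb)
  moreover have "has_pd (\<lambda>y. G (emb y)) (pd (\<lambda>y. G (emb y)) i y) i y" if "emb y \<in> S" for i y
    using Suc.prems that exhaust_2[of i] by (auto simp: Ck_Suc pd_emb has_pd_def emb_axis)
  moreover have "Ck n (emb -` S) (pd (\<lambda>y. G (emb y)) i)" for i
    using Suc.IH Suc.prems exhaust_2[of i] by (auto simp: Ck_Suc pd_emb)
  ultimately show ?case
    by (auto simp: Ck_Suc)
qed

context S3_hypersphere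
begin

lemma isothermal_coordinates:
  assumes p: "p \<in> U"
  shows "\<exists>Om Nb (psi :: real^3 \<Rightarrow> real^3) psi' (D :: (real^2) set) (k :: real^2 \<Rightarrow> real).
           open Om \<and> open Nb \<and> p \<in> Nb \<and> Nb \<subseteq> U \<and>
           smooth_on Om psi \<and> smooth_on Nb psi' \<and> psi ` Om = Nb \<and> psi' ` Nb = Om \<and>
           (\<forall>x\<in>Om. psi' (psi x) = x) \<and> (\<forall>y\<in>Nb. psi (psi' y) = y) \<and>
           open D \<and> vw ` Om \<subseteq> D \<and> smooth_on D k \<and>
           (\<forall>x\<in>Om. a (psi x) = exp (k (vw x))) \<and>
           (\<forall>y\<in>D. lap2 k y = 6 * exp (4/3 * k y))"
proof -
  define E where "E = (\<lambda>b::3. if b = 1 then T else if b = 2 then X else Y)"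
  \<comment> \<open>The sign of \<open>lT\<close> is reversed because it takes the value -1 on T;
    this makes the family dual to T, X, Y and the first coordinate field equal to T.\<close>
  define w where "w = (\<lambda>(b::3) q. \<chi> i. if b = 1 then - lT i q else if b = 2 then etaV i q else etaW i q)"
  have w_ct: "w 1 q \<bullet> Z = - contract Z (\<lambda>i. lT i q)" "w 2 q \<bullet> Z = contract Z (\<lambda>i. etaV i q)"
    "w 3 q \<bullet> Z = contract Z (\<lambda>i. etaW i q)" for q Z
    by (simp_all add: w_def inner_vec_def contract_def mult.commute sum_negf)
  have w_nth: "(\<lambda>q. w 1 q $ i) = (\<lambda>q. - lT i q)" "(\<lambda>q. w 2 q $ i) = etaV i" "(\<lambda>q. w 3 q $ i) = etaW i" for i
    by (simp_all add: w_def)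
  have smE: "smooth_on U (E b)" for b
    unfolding smooth_on_def E_def using Ck_T Ck_XY by simp
  have smw: "smooth_on U (w b)" for b
    unfolding smooth_on_def
  proof
    have "Ck n U (\<lambda>q. w b q $ i)" for n i
      using exhaust_3[of b] w_nth Ck_minus[OF open_U Ck_forms(1)] Ck_eta by metis
    then show "Ck n U (w b)" for n
      by (rule Ck_vec[OF open_U])
  qed
  have dual: "w b x \<bullet> E c x = (if b = c then 1 else 0)" if "x \<in> U" for b c x
  proof -
    have XY_T: "h x (X x) (T x) = 0" "h x (Y x) (T x) = 0"
      by (simp_all add: X_def Y_def h_linear orthonormal[OF that])
    show ?thesis
      using exhaust_3[of b] exhaust_3[of c]
      by (auto simp: w_ct E_def contract_coframe contract_eta[OF that] XY_T orthonormal[OF that])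
  qed
  have closed: "pd (\<lambda>y. w b y $ i) j x = pd (\<lambda>y. w b y $ j) i x" if "x \<in> U" for b i j x
  proof -
    have "pd (\<lambda>q. - lT i q) j x = - pd (lT i) j x" for i j
      by (intro has_pd_imp_pd has_pd_minus has_pd_of_Ck that Ck_forms)
    then show ?thesis
      using exhaust_3[of b] w_nth d_eta[OF that] d_lT[OF that] by metis
  qed
  obtain r Nb psi psi' where coords: "0 < r" "open Nb" "p \<in> Nb" "Nb \<subseteq> U"
    "smooth_on (ball 0 r) psi" "smooth_on Nb psi'" "psi ` ball 0 r = Nb" "psi' ` Nb = ball 0 r"
    "\<forall>x\<in>ball 0 r. psi' (psi x) = x" "\<forall>y\<in>Nb. psi (psi' y) = y"
    "\<forall>x\<in>ball 0 r. \<forall>b. has_pd psi (E b (psi x)) b x"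
    by (rule coordinates_of_closed_coframe[OF open_U p smE smw dual closed])
  let ?B = "ball (0::real^3) r"
  have psiU: "psi x \<in> U" if "x \<in> ?B" for x
    using that coords(4,7) by blast
  have chain: "has_pd (\<lambda>x. f (psi x)) (contract (E b (psi x)) (\<lambda>i. pd f i (psi x))) b x"
    if "Ck (Suc 0) U f" "x \<in> ?B" for f b x
  proof -
    have "has_pd psi (E b (psi x)) b x"
      using coords(11) that(2) by blast
    from has_pd_compose[OF this Ck_has_derivative[OF open_U psiU[OF that(2)] that(1)]] show ?thesis
      by (simp add: contract_def)
  qed
  define F where "F = (\<lambda>x. k (psi x))"
  have CkF: "Ck n ?B F" for n
    unfolding F_def
  proof (rule Ck_compose[OF open_ball open_U _ Ck_k])
    show "psi ` ?B \<subseteq> U"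
      using psiU by blast
    show "Ck n ?B psi"
      using coords(5) unfolding smooth_on_def by blast
  qed
  have dF: "has_pd F (contract (E b (psi x)) (\<lambda>i. pd k i (psi x))) b x" if "x \<in> ?B" for b x
    unfolding F_def by (rule chain[OF Ck_k that])
  have pdF: "pd F 2 x = A (psi x)" "pd F 3 x = B (psi x)" if "x \<in> ?B" for x
    using has_pd_imp_pd[OF dF[OF that, of 2]] has_pd_imp_pd[OF dF[OF that, of 3]]
    by (simp_all add: E_def A_def B_def)
  \<comment> \<open>The second and third coordinate fields are X and Y, so the frame identity
    becomes the flat Laplacian.\<close>
  have lapF: "pd (pd F 2) 2 x + pd (pd F 3) 3 x = 6 * exp (4/3 * F x)" if "x \<in> ?B" for x
  proof -
    have "pd (pd F 2) 2 x = pd (\<lambda>x. A (psi x)) 2 x" "pd (pd F 3) 3 x = pd (\<lambda>x. B (psi x)) 3 x"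
      by (rule pd_cong_open[OF open_ball that], rule pdF, assumption)+
    then show ?thesis
      using has_pd_imp_pd[OF chain[OF Ck_AB(1) that, of 2]] has_pd_imp_pd[OF chain[OF Ck_AB(2) that, of 3]]
        laplace[OF psiU[OF that]] by (simp add: E_def F_def)
  qed
  have emb_vw: "emb (vw x) = x + (- x $ 1) *\<^sub>R axis 1 1" for x
    by (simp add: emb_def vw_def vec_eq_iff forall_3 axis_def)
  \<comment> \<open>T(k) = 0 makes F constant along the first axis, and the segment from x to its
    projection on the slice stays in the ball, since only the size of the first coordinate
    shrinks.\<close>
  have F_const: "F (emb (vw x)) = F x" if "x \<in> ?B" for x
  proof -
    have "((\<lambda>s. F (x + s *\<^sub>R axis 1 1)) has_vector_derivative 0) (at s within closed_segment 0 (- x $ 1))"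
      if s: "s \<in> closed_segment 0 (- x $ 1)" for s
    proof -
      have "\<bar>x $ 1 + s\<bar> \<le> \<bar>x $ 1\<bar>"
        using s by (auto simp: closed_segment_eq_real_ivl split: if_splits)
      then have "norm (x + s *\<^sub>R axis 1 1) \<le> norm x"
        by (intro norm_le_componentwise_cart) (auto simp: axis_def)
      then have "x + s *\<^sub>R axis 1 1 \<in> ?B"
        using \<open>x \<in> ?B\<close> by simp
      from dF[OF this, of 1] have "has_pd F 0 1 (x + s *\<^sub>R axis 1 1)"
        using dk_T[OF psiU[OF \<open>x + s *\<^sub>R axis 1 1 \<in> ?B\<close>]] by (simp add: E_def)
      from has_pd_line[OF this] show ?thesis
        by (rule has_vector_derivative_at_within)
    qed
    then obtain c where c: "\<And>s. s \<in> closed_segment 0 (- x $ 1) \<Longrightarrow> F (x + s *\<^sub>R axis 1 1) = c"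
      by (rule has_vector_derivative_zero_constant[OF convex_closed_segment]) (blast, rule that, blast)
    have "F (emb (vw x)) = c"
      unfolding emb_vw by (rule c) simp
    moreover have "F (x + 0 *\<^sub>R axis 1 1) = c"
      by (rule c) simp
    ultimately show ?thesis
      by simp
  qed
  \<comment> \<open>The required function of (v, w) is F on the slice. Its domain is a disc
    containing all projections of the ball, because dropping a coordinate does not increase the
    norm.\<close>
  define D where "D = emb -` ?B"
  show ?thesis
  proof (intro exI conjI ballI)
    show "open ?B" "open Nb" "p \<in> Nb" "Nb \<subseteq> U" "smooth_on ?B psi" "smooth_on Nb psi'"
      "psi ` ?B = Nb" "psi' ` Nb = ?B"
      by (rule open_ball coords)+
    show "psi' (psi x) = x" if "x \<in> ?B" for x
      using coords(9) that by blast
    show "psi (psi' y) = y" if "y \<in> Nb" for y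
      using coords(10) that by blast
    show "open D"
      unfolding D_def by (intro open_vimage open_ball continuous_on_emb)
    show "vw ` ?B \<subseteq> D"
    proof
      fix y assume "y \<in> vw ` ?B"
      then obtain x where x: "x \<in> ?B" "y = vw x"
        by blast
      have "norm (emb (vw x)) \<le> norm x"
        by (intro norm_le_componentwise_cart) (auto simp: emb_vw axis_def)
      then show "y \<in> D"
        using x by (simp add: D_def)
    qed
    show "smooth_on D (\<lambda>y. F (emb y))"
      unfolding smooth_on_def D_def using Ck_emb[OF CkF] by blast
    show "a (psi x) = exp (F (emb (vw x)))" if "x \<in> ?B" for x
      using F_const[OF that] exp_k[OF psiU[OF that]] by (simp add: F_def)
    show "lap2 (\<lambda>y. F (emb y)) y = 6 * exp (4/3 * F (emb y))" if "y \<in> D" for y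
      using lapF[of "emb y"] that by (simp add: lap2_def pd_emb D_def)
  qed
qed

end

theorem theorem7p32:
  fixes U :: "(real^3) set" and phi xi :: "real^3 \<Rightarrow> real^4"
    and T V W :: "real^3 \<Rightarrow> real^3" and a6 :: "real^3 \<Rightarrow> real"
  assumes hs: "improper_affine_hypersphere U phi xi"
    and indef: "\<forall>p\<in>U. lorentzian (aff_metric phi xi p)"
    and sym: "pointwise_S3_symmetric U phi xi"
    and frame: "S3_frame U phi xi T V W a6"
    and alpha: "\<forall>p\<in>U. alpha22 phi xi T V W p = 0 \<and> alpha23 phi xi T V W p = 0"
  shows "\<forall>p\<in>U. \<exists>Om Nb (psi :: real^3 \<Rightarrow> real^3) psi' (D :: (real^2) set) (k :: real^2 \<Rightarrow> real).
           open Om \<and> open Nb \<and> p \<in> Nb \<and> Nb \<subseteq> U \<and>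
           smooth_on Om psi \<and> smooth_on Nb psi' \<and> psi ` Om = Nb \<and> psi' ` Nb = Om \<and>
           (\<forall>x\<in>Om. psi' (psi x) = x) \<and> (\<forall>y\<in>Nb. psi (psi' y) = y) \<and>
           open D \<and> vw ` Om \<subseteq> D \<and> smooth_on D k \<and>
           (\<forall>x\<in>Om. a6 (psi x) = exp (k (vw x))) \<and>
           (\<forall>y\<in>D. lap2 k y = 6 * exp (4/3 * k y))"
proof -
  interpret S3_hypersphere U phi xi T V W a6
    using hs indef frame alpha by unfold_locales
  show ?thesis
    using isothermal_coordinates by blast
qed

end
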